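(* Let $k$ be an algebraically closed field. For all distinct $a,b,c,d\in\mathbb{Z}$, the skew pentagram map $T_{a,b,c,d}:(\mathbb{P}^2)^{\mathbb{Z}}\dashrightarrow(\mathbb{P}^2)^{\mathbb{Z}}$ over $k$ satisfies $\lambda_1(T_{a,b,c,d})\le 4$.
   Context: $\operatorname{Ind}$ denotes the indeterminacy locus of a rational map. A local rule on $(\mathbb{P}^N)^{\mathbb{Z}}$ is a finite nonempty set $S\subset\mathbb{Z}$ (a neighborhood) with a rational map $\varphi:(\mathbb{P}^N)^S\dashrightarrow\mathbb{P}^N$. The associated lattice map is the partially defined map $T_\varphi:(\mathbb{P}^N)^{\mathbb{Z}}\dashrightarrow(\mathbb{P}^N)^{\mathbb{Z}}$, $(v_i)_{i}\mapsto(\varphi(v_{i+s}:s\in S))_{i}$. For finite nonempty $A\subset\mathbb{Z}$, the regional map $\varphi_A:(\mathbb{P}^N)^{A+S}\dashrightarrow(\mathbb{P}^N)^A$ is $v\mapsto(\varphi(v_{i+s}:s\in S))_{i\in A}$, where $A+S$ is the Minkowski sum. If $T,T'$ have local rules $(S,\varphi),(S',\varphi')$ and the image of $\varphi_{S'}$ is not contained in $\operatorname{Ind}\varphi'$, then $T'\circ T$ is the lattice map with local rule $\varphi'\circ\varphi_{S'}$ on $S+S'$. Iterates are $T^0=\mathrm{Id}$, $T^m=T\circ T^{m-1}$; $T$ is iterable if all iterates exist. The degree $\deg T$ of a lattice map is the total degree of the multihomogeneous polynomials giving a local rule $\varphi$ of $T$ when written without common factors. The dynamical degree of an iterable lattice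 map is $\lambda_1(T)=\lim_{m\to\infty}(\deg T^m)^{1/m}$. For distinct $a,b,c,d\in\mathbb{Z}$, the skew pentagram map $T_{a,b,c,d}$ is the lattice map on $(\mathbb{P}^2)^{\mathbb{Z}}$ with $S=\{a,b,c,d\}$ sending $(v_i)$ to $(v_i')$ with $v_i'=\overline{v_{i+a}v_{i+b}}\cap\overline{v_{i+c}v_{i+d}}$, where $\overline{pq}$ is the line through distinct points $p,q$. It is iterable. *)

theory Defs
  imports
    "HOL-Analysis.Cartesian_Space"
    "HOL-Library.Poly_Mapping"
    "HOL-Library.Set_Algebras"
    "HOL-Library.FuncSet"
    "HOL-Library.Numeral_Type"
    "HOL-Computational_Algebra.Polynomial"
begin

text \<open>Homogeneous coordinates are indexed by a finite type \<open>'n\<close>, so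
  \<open>('k, 'n) proj\<close> is $P^N$ over \<open>'k\<close> with $N + 1 =$ \<open>CARD('n)\<close>, and \<open>('k, 3) proj\<close> is the
  projective plane.\<close>

typedef (overloaded) ('k :: field, 'n :: finite) proj =
  "{L :: ('k ^ 'n) set. \<exists>x. x \<noteq> 0 \<and> L = vec.span {x}}"
proof -
  have "(axis undefined 1 :: 'k ^ 'n) \<noteq> 0"
    by (simp add: axis_eq_0_iff)
  then show ?thesis by blast
qed

text \<open>A point of $(P^N)^S$, for \<open>S\<close> a set of integers, is encoded as a function
  \<open>int \<Rightarrow> ('k, 'n) proj\<close> whose values outside \<open>S\<close> are irrelevant.\<close>

type_synonym ('k, 'n) config = "int \<Rightarrow> ('k, 'n) proj"


subsection \<open>Multihomogeneous polynomials\<close>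

text \<open>The variable \<open>(i, l)\<close> is the \<open>l\<close>-th homogeneous coordinate at site \<open>i\<close>.\<close>

type_synonym ('k, 'n) site_poly = "((int \<times> 'n) \<Rightarrow>\<^sub>0 nat) \<Rightarrow>\<^sub>0 'k"

definition eval_poly :: "('k :: comm_ring_1, 'n) site_poly \<Rightarrow> (int \<times> 'n \<Rightarrow> 'k) \<Rightarrow> 'k" where
  "eval_poly p x =
     (\<Sum>m\<in>Poly_Mapping.keys p.
        Poly_Mapping.lookup p m * (\<Prod>u\<in>Poly_Mapping.keys m. x u ^ Poly_Mapping.lookup m u))"

definition eval_tuple ::
  "('n \<Rightarrow> ('k :: field, 'n :: finite) site_poly) \<Rightarrow> (int \<Rightarrow> 'k ^ 'n) \<Rightarrow> 'k ^ 'n" where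
  "eval_tuple f x = (\<chi> j. eval_poly (f j) (\<lambda>(i, l). x i $ l))"

text \<open>Tuples of polynomials in the variables at the sites \<open>S\<close>, not all zero and all
  multihomogeneous of one multidegree \<open>d\<close>.\<close>

definition multihom_tuple ::
  "int set \<Rightarrow> ('n \<Rightarrow> ('k :: field, 'n :: finite) site_poly) \<Rightarrow> bool" where
  "multihom_tuple S f \<longleftrightarrow>
     (\<exists>j. f j \<noteq> 0) \<and>
     (\<exists>d :: int \<Rightarrow> nat. \<forall>j. \<forall>m\<in>Poly_Mapping.keys (f j).
        Poly_Mapping.keys m \<subseteq> S \<times> UNIV \<and>
        (\<forall>i. (\<Sum>l\<in>UNIV. Poly_Mapping.lookup m (i, l)) = d i))"

definition no_common_factor :: "('n \<Rightarrow> ('k :: field, 'n) site_poly) \<Rightarrow> bool" where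
  "no_common_factor f \<longleftrightarrow> (\<forall>h. (\<forall>j. h dvd f j) \<longrightarrow> h dvd 1)"

definition tuple_degree :: "('n \<Rightarrow> ('k :: field, 'n) site_poly) \<Rightarrow> nat" where
  "tuple_degree f =
     Max ((\<lambda>m. \<Sum>u\<in>Poly_Mapping.keys m. Poly_Mapping.lookup m u) ` (\<Union>j. Poly_Mapping.keys (f j)))"


subsection \<open>Rational maps\<close>

definition same_ratio ::
  "('n \<Rightarrow> ('k :: field, 'n) site_poly) \<Rightarrow> ('n \<Rightarrow> ('k, 'n) site_poly) \<Rightarrow> bool" where
  "same_ratio f g \<longleftrightarrow> (\<forall>i j. f i * g j = f j * g i)"

definition rational_value ::
  "int set \<Rightarrow> ('n \<Rightarrow> ('k :: field, 'n :: finite) site_poly) \<Rightarrow> ('k, 'n) config \<Rightarrow> ('k, 'n) proj \<Rightarrow> bool"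
where
  "rational_value S f v q \<longleftrightarrow>
     (\<exists>g x. multihom_tuple S g \<and> same_ratio f g \<and>
        (\<forall>i. x i \<noteq> 0 \<and> x i \<in> Rep_proj (v i)) \<and>
        eval_tuple g x \<noteq> 0 \<and> eval_tuple g x \<in> Rep_proj q)"

text \<open>The rational map given by the tuple \<open>f\<close>, as a partial function on its maximal domain: it is
  defined at \<open>v\<close> as soon as some tuple with the same ratios does not vanish at \<open>v\<close>.\<close>

definition rational_map_of ::
  "int set \<Rightarrow> ('n \<Rightarrow> ('k :: field, 'n :: finite) site_poly) \<Rightarrow> ('k, 'n) config \<rightharpoonup> ('k, 'n) proj" where
  "rational_map_of S f v =
     (if \<exists>q. rational_value S f v q then Some (THE q. rational_value S f v q) else None)"

definition rational_map ::
  "int set \<Rightarrow> (('k :: field, 'n :: finite) config \<rightharpoonup> ('k, 'n) proj) \<Rightarrow> bool" where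
  "rational_map S \<phi> \<longleftrightarrow> (\<exists>f. multihom_tuple S f \<and> \<phi> = rational_map_of S f)"

definition Ind :: "(('k :: field, 'n :: finite) config \<rightharpoonup> ('k, 'n) proj) \<Rightarrow> ('k, 'n) config set" where
  "Ind \<phi> = - dom \<phi>"


subsection \<open>Lattice maps\<close>

definition shift :: "int \<Rightarrow> (int \<Rightarrow> 'a) \<Rightarrow> int \<Rightarrow> 'a" where
  "shift i v = (\<lambda>s. v (i + s))"

text \<open>Partiality is recorded per site: \<open>T v i = None\<close> means that the \<open>i\<close>-th entry of the image
  of \<open>v\<close> is undefined, and \<open>T\<close> is defined at \<open>v\<close> when no entry is \<open>None\<close>. In this form
  \<open>T\<close> determines its rule as \<open>\<lambda>v. T v 0\<close>; only the neighborhood can be enlarged.\<close>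

type_synonym ('k, 'n) lattice_map = "('k, 'n) config \<Rightarrow> int \<rightharpoonup> ('k, 'n) proj"

definition lattice_map_of ::
  "(('k :: field, 'n :: finite) config \<rightharpoonup> ('k, 'n) proj) \<Rightarrow> ('k, 'n) lattice_map" where
  "lattice_map_of \<phi> v i = \<phi> (shift i v)"

definition local_rule ::
  "int set \<Rightarrow> (('k :: field, 'n :: finite) config \<rightharpoonup> ('k, 'n) proj) \<Rightarrow> ('k, 'n) lattice_map \<Rightarrow> bool"
where
  "local_rule S \<phi> T \<longleftrightarrow> finite S \<and> S \<noteq> {} \<and> rational_map S \<phi> \<and> T = lattice_map_of \<phi>"

definition regional_map ::
  "(('k :: field, 'n :: finite) config \<rightharpoonup> ('k, 'n) proj) \<Rightarrow> int set \<Rightarrow> ('k, 'n) config \<rightharpoonup> ('k, 'n) config"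
where
  "regional_map \<phi> A v =
     (if \<forall>i\<in>A. shift i v \<in> dom \<phi> then Some (\<lambda>i\<in>A. the (\<phi> (shift i v))) else None)"

text \<open>\<open>U\<close> is the composition of \<open>T'\<close> after \<open>T\<close>. Its rule \<open>\<psi>\<close> is the composite of the rational
  maps \<open>\<phi>'\<close> and \<open>regional_map \<phi> S'\<close>, that is, the rational map agreeing with their pointwise
  composition wherever the latter is defined; its domain can be larger.\<close>

definition lattice_comp ::
  "('k :: field, 'n :: finite) lattice_map \<Rightarrow> ('k, 'n) lattice_map \<Rightarrow> ('k, 'n) lattice_map \<Rightarrow> bool" where
  "lattice_comp T' T U \<longleftrightarrow>
     (\<exists>S \<phi> S' \<phi>' \<psi>.
        local_rule S \<phi> T \<and> local_rule S' \<phi>' T' \<and>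
        \<not> ran (regional_map \<phi> S') \<subseteq> Ind \<phi>' \<and>
        local_rule (S + S') \<psi> U \<and>
        (\<forall>v w. regional_map \<phi> S' v = Some w \<and> w \<in> dom \<phi>' \<longrightarrow> \<psi> v = \<phi>' w))"

inductive lattice_iterate ::
  "('k :: field, 'n :: finite) lattice_map \<Rightarrow> nat \<Rightarrow> ('k, 'n) lattice_map \<Rightarrow> bool"
  for T where
  "lattice_iterate T 0 (\<lambda>v i. Some (v i))"
| "lattice_iterate T m U \<Longrightarrow> lattice_comp T U V \<Longrightarrow> lattice_iterate T (Suc m) V"

definition iterable :: "('k :: field, 'n :: finite) lattice_map \<Rightarrow> bool" where
  "iterable T \<longleftrightarrow> (\<forall>m. \<exists>U. lattice_iterate T m U)"

text \<open>By unique factorization, all tuples without common factor that give a local rule of \<open>T\<close>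
  are proportional and have the same degree; \<open>LEAST\<close> merely selects this number.\<close>

definition lattice_degree :: "('k :: field, 'n :: finite) lattice_map \<Rightarrow> nat" where
  "lattice_degree T =
     (LEAST n. \<exists>S f. multihom_tuple S f \<and> no_common_factor f \<and>
        local_rule S (rational_map_of S f) T \<and> n = tuple_degree f)"

text \<open>Meaningful for \<open>iterable\<close> lattice maps, whose iterates exist and are unique.\<close>

definition dynamical_degree :: "('k :: field, 'n :: finite) lattice_map \<Rightarrow> real" where
  "dynamical_degree T =
     lim (\<lambda>m. root m (real (lattice_degree (THE U. lattice_iterate T m U))))"


subsection \<open>Skew pentagram maps\<close>

text \<open>The line through two distinct points, as a two-dimensional linear subspace.\<close>

definition line_through :: "('k :: field, 3) proj \<Rightarrow> ('k, 3) proj \<Rightarrow> ('k ^ 3) set" where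
  "line_through p q = vec.span (Rep_proj p \<union> Rep_proj q)"

text \<open>The intersection of two distinct lines, as a set of vectors, is the one-dimensional subspace
  representing their common point. The rational map is determined by its values at the
  configurations in general position.\<close>

definition skew_pentagram :: "int \<Rightarrow> int \<Rightarrow> int \<Rightarrow> int \<Rightarrow> ('k :: field, 3) lattice_map" where
  "skew_pentagram a b c d =
     (THE T. \<exists>\<phi>. local_rule {a, b, c, d} \<phi> T \<and>
        (\<forall>v. v a \<noteq> v b \<and> v c \<noteq> v d \<and> line_through (v a) (v b) \<noteq> line_through (v c) (v d) \<longrightarrow>
           (\<exists>q. \<phi> v = Some q \<and>
                Rep_proj q = line_through (v a) (v b) \<inter> line_through (v c) (v d))))"

end

theory Submission
  imports Defs
begin

text \<open>
  In coordinates the skew pentagram map sends \<open>x\<close> to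
  \<open>(x\<^sub>a \<times> x\<^sub>b) \<times> (x\<^sub>c \<times> x\<^sub>d)\<close>, a triple of polynomials of total degree 4. Substituting polynomials into
  polynomials multiplies degrees, and cancelling common factors only lowers them, so
  \<open>deg T\<^sup>m\<^sup>+\<^sup>n \<le> deg T\<^sup>m \<cdot> deg T\<^sup>n\<close> and \<open>deg T \<le> 4\<close>. By Fekete's lemma the \<open>m\<close>-th
  roots of \<open>deg T\<^sup>m\<close> converge, and their limit is at most their first term. It remains to
  control which tuples of polynomials represent a given lattice map; its degree is their least one.

  Over an infinite field a nonzero polynomial has a nonzero value, even at a point with no vanishing
  coordinate (\<open>common_nonzero\<close>). Hence polynomials form a domain, and a tuple up to a common factor
  is the same thing as the rational map that it defines (\<open>ratmap_eq_iff\<close>). Two consequences are that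
  compositions and iterates are unique (\<open>lattice_comp_unique\<close>) and that the skew pentagram map is
  the one given by the cross products (\<open>represents_skew_pentagram\<close>).

  Common factors are handled by two elementary devices. The first is \<open>multihom_component\<close>: if a
  tuple is proportional to a multihomogeneous one, so are its multihomogeneous components. It shows
  that a tuple of least degree has no common factor
  (\<open>coprime_if_least_degree\<close>). The second concerns a tuple \<open>f'\<close> for \<open>T'\<close> that vanishes identically
  on the image of \<open>T\<close>, although \<open>T' \<circ> T\<close> exists. With \<open>F(x)\<close> for the image of \<open>x\<close> and a
  suitable constant \<open>y\<close>, the lowest coefficient of \<open>f'(F(x) + t y)\<close> as a polynomial in \<open>t\<close> still
  represents the composition, within the expected degree (\<open>tuple_comp_degree\<close>).

  If some iterate of \<open>T\<close> were undefined, so would be all later ones. The sequence of degrees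
  would then be eventually constant, and the limit of its roots at most 1.
\<close>

abbreviation keys :: "('a \<Rightarrow>\<^sub>0 'b::zero) \<Rightarrow> 'a set" where "keys \<equiv> Poly_Mapping.keys"
abbreviation lookup :: "('a \<Rightarrow>\<^sub>0 'b::zero) \<Rightarrow> 'a \<Rightarrow> 'b" where "lookup \<equiv> Poly_Mapping.lookup"
abbreviation single :: "'a \<Rightarrow> 'b \<Rightarrow> 'a \<Rightarrow>\<^sub>0 'b::zero" where "single \<equiv> Poly_Mapping.single"

section \<open>Evaluation of polynomials in a commutative ring\<close>

definition mono_value :: "('u \<Rightarrow> 'r::comm_ring_1) \<Rightarrow> ('u \<Rightarrow>\<^sub>0 nat) \<Rightarrow> 'r" where
  "mono_value \<sigma> m = (\<Prod>u\<in>keys m. \<sigma> u ^ lookup m u)"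

text \<open>Coefficients are transported by \<open>c\<close> and variables by \<open>\<sigma>\<close>. The generality serves evaluation at
  a point, substitution of polynomials, and evaluation in polynomials with one further parameter.\<close>

definition insertion ::
  "('k::comm_ring_1 \<Rightarrow> 'r::comm_ring_1) \<Rightarrow> ('u \<Rightarrow> 'r) \<Rightarrow> (('u \<Rightarrow>\<^sub>0 nat) \<Rightarrow>\<^sub>0 'k) \<Rightarrow> 'r" where
  "insertion c \<sigma> p = (\<Sum>m\<in>keys p. c (lookup p m) * mono_value \<sigma> m)"

locale ring_homomorphism =
  fixes h :: "'k::comm_ring_1 \<Rightarrow> 'r::comm_ring_1"
  assumes hom_one: "h 1 = 1"
    and hom_add: "h (a + b) = h a + h b"
    and hom_mult: "h (a * b) = h a * h b"
begin

lemma hom_zero: "h 0 = 0"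
  using hom_add[of 0 0] by simp

lemma hom_minus: "h (a - b) = h a - h b"
  using hom_add[of "a - b" b] by (simp add: algebra_simps)

lemma hom_sum: "h (\<Sum>x\<in>A. f x) = (\<Sum>x\<in>A. h (f x))"
  by (induction A rule: infinite_finite_induct) (auto simp: hom_zero hom_add)

lemma hom_prod: "h (\<Prod>x\<in>A. f x) = (\<Prod>x\<in>A. h (f x))"
  by (induction A rule: infinite_finite_induct) (auto simp: hom_one hom_mult)

lemma hom_power: "h (a ^ n) = h a ^ n"
  by (induction n) (auto simp: hom_one hom_mult)

end

lemma mono_value_superset:
  assumes "finite V" "keys m \<subseteq> V"
  shows "mono_value \<sigma> m = (\<Prod>u\<in>V. \<sigma> u ^ lookup m u)"
  unfolding mono_value_def
  by (rule prod.mono_neutral_left) (use assms in \<open>auto simp: in_keys_iff\<close>)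

lemma mono_value_zero [simp]: "mono_value \<sigma> 0 = 1"
  by (simp add: mono_value_def)

lemma mono_value_single [simp]: "mono_value \<sigma> (single u n) = \<sigma> u ^ n"
  by (simp add: mono_value_def)

lemma mono_value_add: "mono_value \<sigma> (m + m') = mono_value \<sigma> m * mono_value \<sigma> m'"
proof -
  let ?V = "keys m \<union> keys m'"
  have "keys (m + m') \<subseteq> ?V" by (rule Poly_Mapping.keys_add)
  then show ?thesis
    by (simp add: mono_value_superset[of ?V] lookup_add power_add prod.distrib)
qed

text \<open>Bilinearity reduces statements about products to pairs of monomials.\<close>

lemma sum_of_monomials: "p = (\<Sum>m\<in>keys p. single m (lookup p m))"
proof (rule poly_mapping_eqI)
  fix k
  have "(\<Sum>m\<in>keys p. lookup p m when m = k) = lookup p k"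
    by (cases "k \<in> keys p") (auto simp: when_def in_keys_iff)
  then show "lookup p k = lookup (\<Sum>m\<in>keys p. single m (lookup p m)) k"
    by (simp add: lookup_sum lookup_single)
qed

lemma mult_as_sum_of_monomials:
  fixes p q :: "('u \<Rightarrow>\<^sub>0 nat) \<Rightarrow>\<^sub>0 'k::comm_ring_1"
  shows "p * q = (\<Sum>m\<in>keys p. \<Sum>m'\<in>keys q. single (m + m') (lookup p m * lookup q m'))"
proof -
  have "p * q = (\<Sum>m\<in>keys p. single m (lookup p m)) * (\<Sum>m\<in>keys q. single m (lookup q m))"
    using sum_of_monomials by metis
  then show ?thesis by (simp add: sum_product mult_single)
qed

context ring_homomorphism
begin

lemma insertion_superset:
  assumes "finite M" "keys p \<subseteq> M"
  shows "insertion h \<sigma> p = (\<Sum>m\<in>M. h (lookup p m) * mono_value \<sigma> m)"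
  unfolding insertion_def
  by (rule sum.mono_neutral_left) (use assms in \<open>auto simp: in_keys_iff hom_zero\<close>)

lemma insertion_single: "insertion h \<sigma> (single m a) = h a * mono_value \<sigma> m"
  by (subst insertion_superset[of "{m}"]) auto

lemma insertion_const: "insertion h \<sigma> (single 0 a) = h a"
  by (simp add: insertion_single)

lemma insertion_var: "insertion h \<sigma> (single (single u 1) 1) = \<sigma> u"
  by (simp add: insertion_single hom_one)

lemma insertion_add: "insertion h \<sigma> (p + q) = insertion h \<sigma> p + insertion h \<sigma> q"
proof -
  let ?M = "keys p \<union> keys q"
  have "keys (p + q) \<subseteq> ?M" by (rule Poly_Mapping.keys_add)
  then show ?thesis
    by (simp add: insertion_superset[of ?M] lookup_add hom_add distrib_right sum.distrib)
qed

lemma insertion_zero [simp]: "insertion h \<sigma> 0 = 0"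
  by (simp add: insertion_def)

lemma insertion_sum: "insertion h \<sigma> (\<Sum>x\<in>A. f x) = (\<Sum>x\<in>A. insertion h \<sigma> (f x))"
  by (induction A rule: infinite_finite_induct) (auto simp: insertion_add)

lemma insertion_mult: "insertion h \<sigma> (p * q) = insertion h \<sigma> p * insertion h \<sigma> q"
proof -
  have "insertion h \<sigma> (p * q) =
      (\<Sum>m\<in>keys p. \<Sum>m'\<in>keys q. h (lookup p m * lookup q m') * mono_value \<sigma> (m + m'))"
    by (subst mult_as_sum_of_monomials) (simp add: insertion_sum insertion_single)
  also have "\<dots> = insertion h \<sigma> p * insertion h \<sigma> q"
    by (simp add: insertion_def sum_product hom_mult mono_value_add mult_ac)
  finally show ?thesis .
qed

lemma insertion_hom: "ring_homomorphism (insertion h \<sigma>)"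
proof
  show "insertion h \<sigma> 1 = 1"
    using insertion_const[of \<sigma> 1] by (simp add: hom_one)
qed (auto simp: insertion_add insertion_mult)

lemma hom_insertion: "h (insertion c \<sigma> p) = insertion (\<lambda>a. h (c a)) (\<lambda>u. h (\<sigma> u)) p"
  by (simp add: insertion_def mono_value_def hom_sum hom_mult hom_prod hom_power)

end

lemma insertion_cong:
  assumes "\<And>m u. m \<in> keys p \<Longrightarrow> u \<in> keys m \<Longrightarrow> \<sigma> u = \<tau> u"
  shows "insertion c \<sigma> p = insertion c \<tau> p"
  unfolding insertion_def mono_value_def
  by (intro sum.cong prod.cong arg_cong2[where f = "(*)"] refl) (auto dest: assms)

global_interpretation eval: ring_homomorphism "\<lambda>a::'k::comm_ring_1. a"
  by unfold_locales auto

global_interpretation const: ring_homomorphism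
  "single 0 :: 'k::comm_ring_1 \<Rightarrow> ('u \<Rightarrow>\<^sub>0 nat) \<Rightarrow>\<^sub>0 'k"
  by unfold_locales (auto simp: single_add mult_single)

lemma eval_poly_eq_insertion: "eval_poly p x = insertion (\<lambda>a. a) x p"
  by (simp add: eval_poly_def insertion_def mono_value_def)

global_interpretation eval_poly: ring_homomorphism "\<lambda>p::('k::comm_ring_1,'n) site_poly. eval_poly p x"
  for x
  unfolding eval_poly_eq_insertion by (rule eval.insertion_hom)

definition variable :: "'u \<Rightarrow> ('u \<Rightarrow>\<^sub>0 nat) \<Rightarrow>\<^sub>0 'k::comm_ring_1" where
  "variable u = single (single u 1) 1"

definition subst_poly ::
  "(int \<times> 'n \<Rightarrow> ('k::comm_ring_1,'n) site_poly) \<Rightarrow> ('k,'n) site_poly \<Rightarrow> ('k,'n) site_poly" where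
  "subst_poly \<sigma> p = insertion (single 0) \<sigma> p"

lemma eval_const [simp]: "eval_poly (single 0 a) x = a"
  by (simp add: eval_poly_eq_insertion eval.insertion_const)

lemma eval_variable [simp]: "eval_poly (variable u) x = x u"
  unfolding eval_poly_eq_insertion variable_def by (rule eval.insertion_var)

lemma eval_subst [simp]: "eval_poly (subst_poly \<sigma> p) x = eval_poly p (\<lambda>u. eval_poly (\<sigma> u) x)"
  unfolding subst_poly_def by (simp add: eval_poly.hom_insertion eval_poly_eq_insertion[of p] )

section \<open>Polynomials over an infinite field as functions\<close>

lemma infinite_alg_closed_field: "infinite (UNIV :: 'k::alg_closed_field set)"
proof
  assume fin: "finite (UNIV :: 'k set)"
  \<comment> \<open>The polynomial of Euclid's argument: it takes the value 1 everywhere.\<close>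
  define p :: "'k poly" where "p = (\<Prod>a\<in>UNIV. [:-a, 1:]) + 1"
  have deg: "degree (\<Prod>a\<in>(UNIV::'k set). [:-a, 1:]) = card (UNIV :: 'k set)"
    by (subst degree_prod_eq_sum_degree) auto
  have pos: "card (UNIV :: 'k set) > 0" using fin by (simp add: card_gt_0_iff)
  have "degree p = card (UNIV :: 'k set)"
    unfolding p_def by (subst degree_add_eq_left) (use deg pos in auto)
  then obtain x where "poly p x = 0" using alg_closed_imp_poly_has_root[of p] pos by auto
  moreover have "poly p x = 1"
    using fin by (auto simp: p_def poly_prod prod_zero_iff)
  ultimately show False by simp
qed

text \<open>Weights that are powers of a large number separate finitely many monomials: two distinct
  monomials agree only for the finitely many bases that are roots of a nonzero polynomial.\<close>

lemma separating_weights: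
  fixes M :: "('u \<Rightarrow>\<^sub>0 nat) set"
  assumes "finite M"
  obtains e :: "'u \<Rightarrow> nat" where "inj_on (\<lambda>m. \<Sum>u\<in>keys m. e u * lookup m u) M"
proof -
  define V where "V = (\<Union>m\<in>M. keys m)"
  have V: "finite V" using assms by (simp add: V_def)
  obtain g :: "'u \<Rightarrow> nat" where g: "inj_on g V"
    using finite_imp_inj_to_nat_seg[OF V] by blast
  define P :: "('u \<Rightarrow>\<^sub>0 nat) \<Rightarrow> ('u \<Rightarrow>\<^sub>0 nat) \<Rightarrow> int poly" where
    "P m m' = (\<Sum>u\<in>V. monom (int (lookup m u) - int (lookup m' u)) (g u))" for m m'
  have P0: "P m m' \<noteq> 0" if "m \<in> M" "m' \<in> M" "m \<noteq> m'" for m m'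
  proof -
    obtain u where u: "lookup m u \<noteq> lookup m' u" using \<open>m \<noteq> m'\<close> by (auto simp: poly_mapping_eq_iff fun_eq_iff)
    then have "u \<in> keys m \<union> keys m'" by (auto simp: in_keys_iff)
    then have uV: "u \<in> V" using that by (auto simp: V_def)
    have "coeff (P m m') (g u) = (\<Sum>w\<in>V. if w = u then int (lookup m w) - int (lookup m' w) else 0)"
      unfolding P_def coeff_sum by (rule sum.cong) (use g uV in \<open>auto simp: inj_on_def\<close>)
    also have "\<dots> = int (lookup m u) - int (lookup m' u)" using V uV by simp
    finally have "coeff (P m m') (g u) \<noteq> 0" using u by simp
    then show ?thesis by auto
  qed
  define B where "B = (\<Union>(m,m')\<in>{(m,m'). m \<in> M \<and> m' \<in> M \<and> m \<noteq> m'}. {x. poly (P m m') x = 0})"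
  have "finite {(m,m'). m \<in> M \<and> m' \<in> M \<and> m \<noteq> m'}"
    by (rule finite_subset[of _ "M \<times> M"]) (use assms in auto)
  then have "finite B" unfolding B_def using P0 by (auto intro!: poly_roots_finite)
  then have "finite (int -` B)" by (simp add: finite_vimageI)
  then obtain t :: nat where t: "int t \<notin> B" using ex_new_if_finite[OF infinite_UNIV_nat] by blast
  have "inj_on (\<lambda>m. \<Sum>u\<in>keys m. t ^ g u * lookup m u) M"
  proof (rule inj_onI, rule ccontr)
    fix m m' assume m: "m \<in> M" "m' \<in> M" "m \<noteq> m'"
      and eq: "(\<Sum>u\<in>keys m. t ^ g u * lookup m u) = (\<Sum>u\<in>keys m'. t ^ g u * lookup m' u)"
    have ext: "(\<Sum>u\<in>keys m. t ^ g u * lookup m u) = (\<Sum>u\<in>V. t ^ g u * lookup m u)" if "m \<in> M" for m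
      by (rule sum.mono_neutral_left) (use that V in \<open>auto simp: V_def in_keys_iff\<close>)
    have "poly (P m m') (int t) = (\<Sum>u\<in>V. (int (lookup m u) - int (lookup m' u)) * int t ^ g u)"
      by (simp add: P_def poly_sum poly_monom)
    also have "\<dots> = int (\<Sum>u\<in>V. t ^ g u * lookup m u) - int (\<Sum>u\<in>V. t ^ g u * lookup m' u)"
      by (simp add: sum_subtractf algebra_simps)
    also have "\<dots> = 0" using eq ext m by simp
    finally have "int t \<in> B" using m by (auto simp: B_def)
    then show False using t by simp
  qed
  then show thesis by (rule that)
qed

text \<open>Substituting powers of one scalar for the variables, with separating exponents, turns
  finitely many nonzero polynomials into nonzero polynomials in one variable; any nonzero scalar
  outside their finite sets of roots will do.\<close>

lemma common_nonzero:
  fixes P :: "('k::alg_closed_field,'n) site_poly set"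
  assumes fin: "finite P" and nz: "0 \<notin> P"
  obtains x where "\<And>u. x u \<noteq> 0" "\<And>p. p \<in> P \<Longrightarrow> eval_poly p x \<noteq> 0"
proof -
  obtain e :: "int \<times> 'n \<Rightarrow> nat"
    where inj: "inj_on (\<lambda>m. \<Sum>u\<in>keys m. e u * lookup m u) (\<Union>p\<in>P. keys p)"
    using separating_weights[of "\<Union>p\<in>P. keys p"] fin by auto
  define w where "w m = (\<Sum>u\<in>keys m. e u * lookup m u)" for m
  define Q :: "('k,'n) site_poly \<Rightarrow> 'k poly" where
    "Q p = (\<Sum>m\<in>keys p. monom (lookup p m) (w m))" for p
  have eval_Q: "eval_poly p (\<lambda>u. s ^ e u) = poly (Q p) s" for p s
    by (simp add: eval_poly_def Q_def poly_sum poly_monom w_def power_sum power_mult)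
  have Q0: "Q p \<noteq> 0" if "p \<in> P" for p
  proof -
    have "p \<noteq> 0" using that nz by auto
    then obtain m where m: "m \<in> keys p" using keys_eq_empty by blast
    have "coeff (Q p) (w m) = (\<Sum>m'\<in>keys p. if m' = m then lookup p m' else 0)"
      unfolding Q_def coeff_sum
      by (rule sum.cong) (use inj m that in \<open>auto simp: w_def inj_on_def\<close>)
    also have "\<dots> = lookup p m" using m by simp
    finally have "coeff (Q p) (w m) \<noteq> 0" using m by (simp add: in_keys_iff)
    then show ?thesis by auto
  qed
  have "finite (insert 0 (\<Union>p\<in>P. {s. poly (Q p) s = 0}))"
    using fin Q0 by (auto intro!: poly_roots_finite)
  then obtain s where s: "s \<notin> insert 0 (\<Union>p\<in>P. {s. poly (Q p) s = 0})"
    using ex_new_if_finite[OF infinite_alg_closed_field] by blast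
  show thesis by (rule that[of "\<lambda>u. s ^ e u"]) (use s eval_Q in auto)
qed

abbreviation value_at :: "('k::field,'n::finite) site_poly \<Rightarrow> (int \<Rightarrow> 'k ^ 'n) \<Rightarrow> 'k" where
  "value_at p x \<equiv> eval_poly p (\<lambda>(i, l). x i $ l)"

lemma common_nonzero_vectors:
  fixes P :: "('k::alg_closed_field,'n::finite) site_poly set"
  assumes "finite P" and "0 \<notin> P"
  obtains x where "\<And>i. x i \<noteq> 0" "\<And>p. p \<in> P \<Longrightarrow> value_at p x \<noteq> 0"
proof -
  obtain y where y: "\<And>u. y u \<noteq> 0" "\<And>p. p \<in> P \<Longrightarrow> eval_poly p y \<noteq> 0"
    using common_nonzero[OF assms] by blast
  define x :: "int \<Rightarrow> 'k ^ 'n" where "x i = (\<chi> l. y (i, l))" for i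
  have "(\<lambda>(i, l). x i $ l) = y" by (auto simp: x_def)
  moreover have "x i \<noteq> 0" for i using y(1) by (auto simp: x_def vec_eq_iff)
  ultimately show thesis using that y(2) by metis
qed

lemma site_poly_eqI:
  fixes p q :: "('k::alg_closed_field,'n::finite) site_poly"
  assumes "\<And>x. value_at p x = value_at q x"
  shows "p = q"
proof (rule ccontr)
  assume "p \<noteq> q"
  then obtain x where "value_at (p - q) x \<noteq> 0"
    using common_nonzero_vectors[of "{p - q}"] by auto
  then show False using assms by (simp add: eval_poly.hom_minus)
qed

lemma site_poly_no_zero_divisors:
  fixes p q :: "('k::alg_closed_field,'n::finite) site_poly"
  assumes "p \<noteq> 0" "q \<noteq> 0"
  shows "p * q \<noteq> 0"
proof -
  obtain x where "value_at p x \<noteq> 0" "value_at q x \<noteq> 0"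
    using common_nonzero_vectors[of "{p, q}"] assms by (metis finite.emptyI finite.insertI insert_iff singletonD)
  then have "value_at (p * q) x \<noteq> 0" by (simp add: eval_poly.hom_mult)
  then show ?thesis by (auto simp: eval_poly.hom_zero)
qed

section \<open>Weighted components\<close>

definition total_degree :: "('u \<Rightarrow>\<^sub>0 nat) \<Rightarrow> nat" where
  "total_degree m = (\<Sum>u\<in>keys m. lookup m u)"

definition multidegree :: "((int \<times> 'n::finite) \<Rightarrow>\<^sub>0 nat) \<Rightarrow> int \<Rightarrow> nat" where
  "multidegree m i = (\<Sum>l\<in>UNIV. lookup m (i, l))"

lemma total_degree_superset:
  assumes "finite V" "keys m \<subseteq> V"
  shows "total_degree m = (\<Sum>u\<in>V. lookup m u)"
  unfolding total_degree_def
  by (rule sum.mono_neutral_left) (use assms in \<open>auto simp: in_keys_iff\<close>)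

lemma total_degree_add: "total_degree (m + m') = total_degree m + total_degree m'"
proof -
  let ?V = "keys m \<union> keys m'"
  have "keys (m + m') \<subseteq> ?V" by (rule Poly_Mapping.keys_add)
  then show ?thesis by (simp add: total_degree_superset[of ?V] lookup_add sum.distrib)
qed

lemma total_degree_zero [simp]: "total_degree 0 = 0"
  by (simp add: total_degree_def)

lemma total_degree_single [simp]: "total_degree (single u n) = n"
  by (simp add: total_degree_def)

lemma total_degree_eq_0_iff: "total_degree m = 0 \<longleftrightarrow> m = 0"
proof
  assume "total_degree m = 0"
  then have "lookup m u = 0" for u by (cases "u \<in> keys m") (auto simp: total_degree_def in_keys_iff)
  then show "m = 0" by (intro poly_mapping_eqI) simp
qed simp

lemma multidegree_add: "multidegree (m + m') = (\<lambda>i. multidegree m i + multidegree m' i)"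
  by (auto simp: multidegree_def lookup_add sum.distrib)

lemma multidegree_eq_0_iff: "multidegree m i = 0 \<longleftrightarrow> i \<notin> fst ` keys m"
  by (force simp: multidegree_def in_keys_iff)

definition component ::
  "(('u \<Rightarrow>\<^sub>0 nat) \<Rightarrow> 'w) \<Rightarrow> 'w \<Rightarrow> (('u \<Rightarrow>\<^sub>0 nat) \<Rightarrow>\<^sub>0 'k::comm_ring_1) \<Rightarrow> (('u \<Rightarrow>\<^sub>0 nat) \<Rightarrow>\<^sub>0 'k)" where
  "component w d p = (\<Sum>m\<in>keys p. if w m = d then single m (lookup p m) else 0)"

lemma lookup_component: "lookup (component w d p) m = (if w m = d then lookup p m else 0)"
proof -
  have "lookup (component w d p) m = (\<Sum>m'\<in>keys p. if m' = m then (if w m = d then lookup p m else 0) else 0)"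
    unfolding component_def lookup_sum by (rule sum.cong) (auto simp: lookup_single when_def)
  then show ?thesis by (auto simp: in_keys_iff)
qed

lemma keys_component: "keys (component w d p) = {m \<in> keys p. w m = d}"
  by (auto simp: in_keys_iff lookup_component split: if_splits)

lemma component_add: "component w d (p + q) = component w d p + component w d q"
  by (rule poly_mapping_eqI) (auto simp: lookup_component lookup_add)

lemma component_sum: "component w d (\<Sum>x\<in>A. f x) = (\<Sum>x\<in>A. component w d (f x))"
  by (induction A rule: infinite_finite_induct) (auto simp: component_add component_def[of _ _ 0])

lemma component_single: "component w d (single m a) = (if w m = d then single m a else 0)"
  by (rule poly_mapping_eqI) (auto simp: lookup_component lookup_single when_def)

lemma component_mult:
  assumes "\<And>m m'. m \<in> keys p \<Longrightarrow> m' \<in> keys q \<Longrightarrow> w (m + m') = D \<longleftrightarrow> w m = d \<and> w m' = e"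
  shows "component w D (p * q) = component w d p * component w e q"
proof -
  have "component w D (p * q) = (\<Sum>m\<in>keys p. \<Sum>m'\<in>keys q.
      if w m = d \<and> w m' = e then single (m + m') (lookup p m * lookup q m') else 0)"
    by (subst mult_as_sum_of_monomials)
       (auto simp: component_sum component_single assms intro!: sum.cong)
  also have "\<dots> = component w d p * component w e q"
    by (auto simp: component_def[of _ _ p] component_def[of _ _ q] sum_product mult_single
        intro!: sum.cong)
  finally show ?thesis .
qed

lemma component_eq_self: "(\<And>m. m \<in> keys p \<Longrightarrow> w m = d) \<Longrightarrow> component w d p = p"
  by (rule poly_mapping_eqI) (auto simp: lookup_component in_keys_iff)

lemma eval_poly_eq_sum_components:
  "eval_poly p x = (\<Sum>d\<in>w ` keys p. eval_poly (component w d p) x)"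
proof -
  have "p = (\<Sum>d\<in>w ` keys p. component w d p)"
  proof (rule poly_mapping_eqI)
    fix m
    show "lookup p m = lookup (\<Sum>d\<in>w ` keys p. component w d p) m"
      by (auto simp: lookup_sum lookup_component in_keys_iff)
  qed
  then show ?thesis by (metis eval_poly.hom_sum)
qed

section \<open>Tuples up to a common factor\<close>

abbreviation nonzero :: "('n \<Rightarrow> ('k::field,'n) site_poly) \<Rightarrow> bool" where
  "nonzero f \<equiv> \<exists>j. f j \<noteq> 0"

text \<open>Forgetting the set of sites loses nothing: a tuple contains only finitely many variables.\<close>

abbreviation multihom :: "('n \<Rightarrow> ('k :: field, 'n :: finite) site_poly) \<Rightarrow> bool" where
  "multihom \<equiv> multihom_tuple UNIV"

lemma eval_tuple_nth [simp]: "eval_tuple f x $ j = value_at (f j) x"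
  by (simp add: eval_tuple_def)

lemma eval_tuple_eq_0_iff: "eval_tuple f x = 0 \<longleftrightarrow> (\<forall>j. value_at (f j) x = 0)"
  by (simp add: vec_eq_iff)

lemma nonzero_if_eval: "eval_tuple f x \<noteq> 0 \<Longrightarrow> nonzero f"
  by (metis eval_poly.hom_zero eval_tuple_eq_0_iff)

lemma nonzero_eval:
  fixes f :: "'n::finite \<Rightarrow> ('k::alg_closed_field,'n) site_poly"
  assumes "nonzero f"
  obtains x where "\<And>i. x i \<noteq> 0" "eval_tuple f x \<noteq> 0"
proof -
  obtain j where "f j \<noteq> 0" using assms by blast
  then obtain x where "\<And>i. x i \<noteq> 0" "value_at (f j) x \<noteq> 0"
    using common_nonzero_vectors[of "{f j}"] by (metis finite.emptyI finite.insertI singletonD singletonI)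
  then show thesis using that eval_tuple_eq_0_iff by blast
qed

lemma multihom_iff:
  "multihom f \<longleftrightarrow> nonzero f \<and> (\<exists>d. \<forall>j. \<forall>m\<in>keys (f j). multidegree m = d)"
  by (auto simp: multihom_tuple_def multidegree_def fun_eq_iff)

lemma multihom_tuple_iff:
  "multihom_tuple S f \<longleftrightarrow> multihom f \<and> (\<forall>j. \<forall>m\<in>keys (f j). keys m \<subseteq> S \<times> UNIV)"
  unfolding multihom_tuple_def by (auto; blast)

lemma multihom_nonzero: "multihom f \<Longrightarrow> nonzero f"
  by (simp add: multihom_iff)

lemma multihom_finite_sites:
  assumes "multihom f"
  obtains S where "finite S" "0 \<in> S" "multihom_tuple S f"
proof
  let ?S = "insert 0 (\<Union>j. \<Union>m\<in>keys (f j). fst ` keys m)"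
  show "finite ?S" by simp
  show "multihom_tuple ?S f"
    using assms by (subst multihom_tuple_iff) force
qed simp

lemma same_ratio_refl [simp]: "same_ratio f f"
  by (simp add: same_ratio_def mult.commute)

lemma same_ratio_sym: "same_ratio f g \<Longrightarrow> same_ratio g f"
  unfolding same_ratio_def by (metis mult.commute)

text \<open>Transitivity needs a nonzero tuple in the middle and cancellation of one of its entries.\<close>

lemma same_ratio_trans:
  fixes f g h :: "'n::finite \<Rightarrow> ('k::alg_closed_field,'n) site_poly"
  assumes fg: "same_ratio f g" and gh: "same_ratio g h" and g: "nonzero g"
  shows "same_ratio f h"
  unfolding same_ratio_def
proof (intro allI)
  fix i j
  obtain l where l: "g l \<noteq> 0" using g by blast
  have fgl: "f a * g l = f l * g a" for a using fg by (simp add: same_ratio_def)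
  have "g l * (f i * h j) = (f i * g l) * h j" by (simp add: algebra_simps)
  also have "\<dots> = f l * (g i * h j)" by (simp add: fgl mult.assoc)
  also have "\<dots> = f l * (g j * h i)" using gh by (simp add: same_ratio_def)
  also have "\<dots> = (f j * g l) * h i" by (simp add: fgl mult.assoc)
  also have "\<dots> = g l * (f j * h i)" by (simp add: algebra_simps)
  finally have "g l * (f i * h j - f j * h i) = 0" by (simp add: algebra_simps)
  then show "f i * h j = f j * h i" using site_poly_no_zero_divisors[OF l] by (metis eq_iff_diff_eq_0)
qed

lemma same_ratioI_value:
  fixes f g :: "'n::finite \<Rightarrow> ('k::alg_closed_field,'n) site_poly"
  assumes "\<And>x i j. value_at (f i) x * value_at (g j) x = value_at (f j) x * value_at (g i) x"
  shows "same_ratio f g"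
  unfolding same_ratio_def
  by (intro allI site_poly_eqI) (simp add: eval_poly.hom_mult assms)

lemma same_ratio_value:
  "same_ratio f g \<Longrightarrow> value_at (f i) x * value_at (g j) x = value_at (f j) x * value_at (g i) x"
  unfolding same_ratio_def by (metis eval_poly.hom_mult)

text \<open>Being proportional to a multihomogeneous tuple passes to the multihomogeneous components,
  because the components of a product with a multihomogeneous factor are the products of
  the components with that factor. This replaces a gcd computation wherever a multihomogeneous
  representative is needed: no degree grows, no variable is added, and the component can be
  chosen not to vanish at a given point.\<close>

lemma multihom_component:
  fixes p q :: "'n::finite \<Rightarrow> ('k::field,'n) site_poly"
  assumes q: "multihom q" and pq: "same_ratio p q" and x: "eval_tuple p x \<noteq> 0"
  obtains g where "multihom g" "same_ratio g q" "eval_tuple g x \<noteq> 0"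
    "\<And>j. keys (g j) \<subseteq> keys (p j)"
proof -
  obtain e where e: "\<And>j m. m \<in> keys (q j) \<Longrightarrow> multidegree m = e"
    using q by (auto simp: multihom_iff)
  obtain j where j: "value_at (p j) x \<noteq> 0" using x by (auto simp: eval_tuple_eq_0_iff)
  have "value_at (p j) x = (\<Sum>d\<in>multidegree ` keys (p j). value_at (component multidegree d (p j)) x)"
    by (rule eval_poly_eq_sum_components)
  then obtain d where d: "value_at (component multidegree d (p j)) x \<noteq> 0"
    using j by (metis (no_types, lifting) sum.neutral)
  define g where "g j = component multidegree d (p j)" for j
  have mult: "g a * q b = component multidegree (\<lambda>i. d i + e i) (p a * q b)" for a b
    unfolding g_def
    by (subst component_mult[where d = d and e = e])
       (auto simp: multidegree_add fun_eq_iff e component_eq_self)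
  have "same_ratio g q" using pq by (simp add: same_ratio_def mult)
  moreover have gx: "eval_tuple g x \<noteq> 0" using d by (auto simp: eval_tuple_eq_0_iff g_def)
  moreover have "multihom g"
    using nonzero_if_eval[OF gx] by (auto simp: multihom_iff g_def keys_component)
  ultimately show thesis using that by (auto simp: g_def keys_component)
qed

lemma tuple_degree_eq: "tuple_degree f = Max (total_degree ` (\<Union>j. keys (f j)))"
  by (simp add: tuple_degree_def total_degree_def)

lemma total_degree_le_tuple_degree:
  fixes f :: "'n::finite \<Rightarrow> ('k::field,'n) site_poly"
  assumes "m \<in> keys (f j)" shows "total_degree m \<le> tuple_degree f"
  unfolding tuple_degree_eq by (rule Max_ge) (use assms in auto)

lemma tuple_degree_le:
  fixes f :: "'n::finite \<Rightarrow> ('k::field,'n) site_poly"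
  assumes "nonzero f" "\<And>j m. m \<in> keys (f j) \<Longrightarrow> total_degree m \<le> n"
  shows "tuple_degree f \<le> n"
proof -
  have "(\<Union>j. keys (f j)) \<noteq> {}" using assms(1) keys_eq_empty by blast
  then show ?thesis unfolding tuple_degree_eq by (subst Max_le_iff) (use assms(2) in auto)
qed

lemma keys_subset_zero_imp_const: "keys p \<subseteq> {0} \<Longrightarrow> p = single 0 (lookup p 0)"
  by (rule poly_mapping_eqI) (auto simp: lookup_single when_def in_keys_iff)

text \<open>In a domain the components of top degree have a nonzero product.\<close>

lemma total_degree_factor:
  fixes h p :: "('k::alg_closed_field,'n::finite) site_poly"
  assumes hp: "\<And>m. m \<in> keys (h * p) \<Longrightarrow> total_degree m \<le> N"
    and m: "m \<in> keys h" and m': "m' \<in> keys p"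
  shows "total_degree m + total_degree m' \<le> N"
proof -
  define A where "A = Max (total_degree ` keys h)"
  define B where "B = Max (total_degree ` keys p)"
  have le: "\<And>m. m \<in> keys h \<Longrightarrow> total_degree m \<le> A" "\<And>m. m \<in> keys p \<Longrightarrow> total_degree m \<le> B"
    by (auto simp: A_def B_def)
  have "A \<in> total_degree ` keys h" "B \<in> total_degree ` keys p"
    unfolding A_def B_def using m m' by (intro Max_in; auto)+
  then have "component total_degree A h \<noteq> 0" "component total_degree B p \<noteq> 0"
    unfolding keys_eq_empty[symmetric] by (auto simp: keys_component)
  then have "component total_degree A h * component total_degree B p \<noteq> 0"
    by (rule site_poly_no_zero_divisors)
  moreover have "component total_degree (A + B) (h * p) = component total_degree A h * component total_degree B p"
    by (rule component_mult) (use le in \<open>force simp: total_degree_add\<close>)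
  ultimately have "component total_degree (A + B) (h * p) \<noteq> 0" by simp
  then obtain k where "k \<in> keys (h * p)" "total_degree k = A + B"
    unfolding keys_eq_empty[symmetric] by (auto simp: keys_component)
  then have "A + B \<le> N" using hp by metis
  then show ?thesis using le m m' by force
qed

text \<open>Division by a nonconstant common factor, followed by the choice of a multihomogeneous
  component, would give a tuple of lower degree with the same ratios.\<close>

lemma coprime_if_least_degree:
  fixes f :: "'n::finite \<Rightarrow> ('k::alg_closed_field,'n) site_poly"
  assumes f: "multihom f"
    and least: "\<And>g. multihom g \<Longrightarrow> same_ratio g f \<Longrightarrow> tuple_degree f \<le> tuple_degree g"
  shows "no_common_factor f"
  unfolding no_common_factor_def
proof (intro allI impI)
  fix h assume h: "\<forall>j. h dvd f j"
  then obtain p where p: "\<And>j. f j = h * p j" unfolding dvd_def by metis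
  obtain j where j: "f j \<noteq> 0" using f multihom_nonzero by blast
  then have h0: "h \<noteq> 0" and pj: "p j \<noteq> 0" using p by auto
  show "h dvd 1"
  proof (cases "keys h \<subseteq> {0}")
    case True
    then have hc: "h = single 0 (lookup h 0)" by (rule keys_subset_zero_imp_const)
    then have "lookup h 0 \<noteq> 0" using h0 by auto
    then have "h * single 0 (inverse (lookup h 0)) = 1"
      by (subst hc) (simp add: mult_single)
    then show ?thesis by (metis dvd_triv_left)
  next
    case False
    then obtain m where m: "m \<in> keys h" "m \<noteq> 0" by auto
    have "same_ratio p f" by (auto simp: same_ratio_def p mult_ac)
    moreover obtain x where "eval_tuple p x \<noteq> 0"
      using nonzero_eval[of p] pj by blast
    ultimately obtain g where g: "multihom g" "same_ratio g f" "\<And>j. keys (g j) \<subseteq> keys (p j)"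
      using multihom_component[OF f] by metis
    have lt: "total_degree m + total_degree m' \<le> tuple_degree f" if "m' \<in> keys (g i)" for m' i
    proof (rule total_degree_factor[OF _ m(1), of "p i"])
      show "total_degree k \<le> tuple_degree f" if "k \<in> keys (h * p i)" for k
        using that p total_degree_le_tuple_degree by metis
      show "m' \<in> keys (p i)" using that g(3) by blast
    qed
    have "tuple_degree f \<le> tuple_degree g" by (rule least[OF g(1,2)])
    moreover have "tuple_degree g \<le> tuple_degree f - total_degree m"
      by (rule tuple_degree_le[OF multihom_nonzero[OF g(1)]]) (use lt in force)
    moreover have "total_degree m \<noteq> 0" using m(2) total_degree_eq_0_iff by blast
    moreover obtain i m' where "m' \<in> keys (g i)"
      using multihom_nonzero[OF g(1)] keys_eq_empty by blast
    ultimately show ?thesis using lt by fastforce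
  qed
qed

section \<open>Projective points and rational maps\<close>

definition pt :: "'k::field ^ 'n::finite \<Rightarrow> ('k, 'n) proj" where
  "pt x = Abs_proj (vec.span {x})"

lemma Rep_pt: "x \<noteq> 0 \<Longrightarrow> Rep_proj (pt x) = vec.span {x}"
  unfolding pt_def by (rule Abs_proj_inverse) auto

lemma pt_exists: "\<exists>x. x \<noteq> 0 \<and> q = pt x"
proof -
  obtain x where "x \<noteq> 0" "Rep_proj q = vec.span {x}" using Rep_proj[of q] by auto
  then show ?thesis unfolding pt_def by (metis Rep_proj_inverse)
qed

lemma pt_eq_iff:
  fixes x y :: "'k::field ^ 'n::finite"
  assumes "x \<noteq> 0" "y \<noteq> 0"
  shows "pt x = pt y \<longleftrightarrow> (\<exists>c. c \<noteq> 0 \<and> x = c *s y)"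
proof
  assume "pt x = pt y"
  then have "vec.span {x} = vec.span {y}" using Rep_pt assms by metis
  then have "x \<in> vec.span {y}" using vec.span_base[of x "{x}"] by auto
  then obtain c where "x = c *s y" by (auto simp: vec.span_singleton)
  moreover from this have "c \<noteq> 0" using assms by auto
  ultimately show "\<exists>c. c \<noteq> 0 \<and> x = c *s y" by blast
next
  assume "\<exists>c. c \<noteq> 0 \<and> x = c *s y"
  then obtain c where c: "c \<noteq> 0" "x = c *s y" by blast
  have "x \<in> vec.span {y}" unfolding c(2) by (intro vec.span_scale vec.span_base) simp
  moreover have "y = (1 / c) *s x" using c by (simp add: vec_eq_iff)
  then have "y \<in> vec.span {x}" by (metis vec.span_scale vec.span_base singletonI)
  ultimately have "vec.span {x} = vec.span {y}" by (simp add: vec.span_eq)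
  then show "pt x = pt y" by (simp add: pt_def)
qed

lemma in_Rep_proj_iff:
  assumes "y \<noteq> 0" shows "y \<in> Rep_proj q \<longleftrightarrow> q = pt y"
proof -
  obtain x where x: "x \<noteq> 0" "q = pt x" using pt_exists by blast
  have "y \<in> Rep_proj q \<longleftrightarrow> (\<exists>c. y = c *s x)"
    using x by (auto simp: Rep_pt vec.span_singleton)
  also have "\<dots> \<longleftrightarrow> (\<exists>c. c \<noteq> 0 \<and> y = c *s x)" using assms by auto
  finally show ?thesis using pt_eq_iff[OF assms x(1)] x by auto
qed

lemma pt_eq_iff_minors:
  fixes x y :: "'k::field ^ 'n::finite"
  assumes "x \<noteq> 0" "y \<noteq> 0"
  shows "pt x = pt y \<longleftrightarrow> (\<forall>i j. x $ i * y $ j = x $ j * y $ i)"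
proof -
  have "\<exists>c. c \<noteq> 0 \<and> x = c *s y" if m: "\<forall>i j. x $ i * y $ j = x $ j * y $ i"
  proof -
    obtain j where j: "y $ j \<noteq> 0" using assms by (auto simp: vec_eq_iff)
    have "x = (x $ j / y $ j) *s y" using j m by (simp add: vec_eq_iff field_simps)
    moreover from this have "x $ j / y $ j \<noteq> 0" using assms by force
    ultimately show ?thesis by blast
  qed
  then show ?thesis unfolding pt_eq_iff[OF assms] by auto
qed

text \<open>A choice of homogeneous coordinates at every site. Scaling the choice scales the values of
  a multihomogeneous tuple, so that all constructions below may fix one.\<close>

definition coords :: "(int \<Rightarrow> 'k::field ^ 'n::finite) \<Rightarrow> ('k,'n) config \<Rightarrow> bool" where
  "coords x v \<longleftrightarrow> (\<forall>i. x i \<noteq> 0 \<and> v i = pt (x i))"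

lemma coords_exist: "\<exists>x. coords x v"
proof -
  have "\<forall>i. \<exists>x. x \<noteq> 0 \<and> v i = pt x" using pt_exists by blast
  then show ?thesis unfolding coords_def by (rule choice)
qed

lemma rational_value_iff:
  "rational_value S f v q \<longleftrightarrow>
     (\<exists>g x. multihom_tuple S g \<and> same_ratio f g \<and> coords x v \<and>
        eval_tuple g x \<noteq> 0 \<and> q = pt (eval_tuple g x))"
  unfolding rational_value_def coords_def using in_Rep_proj_iff by metis

text \<open>Every monomial of multidegree \<open>d\<close> picks up the same factor, the product of all \<open>c i ^ d i\<close>.\<close>

lemma multihom_scale:
  fixes g :: "'n::finite \<Rightarrow> ('k::field,'n) site_poly"
  assumes g: "multihom_tuple S g" and y: "\<And>i. i \<in> S \<Longrightarrow> c i \<noteq> 0 \<and> y i = c i *s x i"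
  obtains k where "k \<noteq> 0" "eval_tuple g y = k *s eval_tuple g x"
proof -
  have gU: "multihom g" and S: "\<And>j m. m \<in> keys (g j) \<Longrightarrow> keys m \<subseteq> S \<times> UNIV"
    using g multihom_tuple_iff by blast+
  obtain d where d: "\<And>j m. m \<in> keys (g j) \<Longrightarrow> multidegree m = d"
    using gU by (auto simp: multihom_iff)
  define I where "I = {i. d i \<noteq> 0}"
  have sites: "fst ` keys m = I" if "m \<in> keys (g j)" for m j
    using multidegree_eq_0_iff[of m] by (auto simp: I_def d[OF that, symmetric] simp del: neq0_conv)
  obtain j0 where "g j0 \<noteq> 0" using multihom_nonzero[OF gU] by blast
  then obtain m0 where m0: "m0 \<in> keys (g j0)" using keys_eq_empty by blast
  have I: "finite I" using sites[OF m0] finite_keys by (metis finite_imageI)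
  have IS: "I \<subseteq> S" using sites[OF m0] S[OF m0] by force
  define k where "k = (\<Prod>i\<in>I. c i ^ d i)"
  have c_prod: "(\<Prod>u\<in>keys m. c (fst u) ^ lookup m u) = k" if m: "m \<in> keys (g j)" for m j
  proof -
    have "(\<Prod>u\<in>keys m. c (fst u) ^ lookup m u) = (\<Prod>u\<in>I \<times> UNIV. c (fst u) ^ lookup m u)"
      by (rule prod.mono_neutral_left) (use I sites[OF m] in \<open>force simp: in_keys_iff\<close>)+
    also have "\<dots> = (\<Prod>i\<in>I. \<Prod>l\<in>UNIV. c i ^ lookup m (i, l))"
      by (subst prod.cartesian_product) (simp add: case_prod_beta)
    also have "\<dots> = k"
      unfolding k_def d[OF m, symmetric] by (simp add: multidegree_def power_sum)
    finally show ?thesis .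
  qed
  have "value_at (g j) y = k * value_at (g j) x" for j
  proof -
    have "(\<Prod>u\<in>keys m. (case u of (i, l) \<Rightarrow> y i $ l) ^ lookup m u) =
        k * (\<Prod>u\<in>keys m. (case u of (i, l) \<Rightarrow> x i $ l) ^ lookup m u)" if m: "m \<in> keys (g j)" for m
    proof -
      have "(\<Prod>u\<in>keys m. (case u of (i, l) \<Rightarrow> y i $ l) ^ lookup m u) =
          (\<Prod>u\<in>keys m. c (fst u) ^ lookup m u * (case u of (i, l) \<Rightarrow> x i $ l) ^ lookup m u)"
        by (rule prod.cong) (use S[OF m] y in \<open>auto simp: power_mult_distrib\<close>)
      then show ?thesis by (simp add: prod.distrib c_prod[OF m])
    qed
    then show ?thesis by (simp add: eval_poly_def sum_distrib_left mult_ac)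
  qed
  then have "eval_tuple g y = k *s eval_tuple g x" by (simp add: vec_eq_iff)
  moreover have "k \<noteq> 0" using I IS y by (auto simp: k_def)
  ultimately show thesis using that by blast
qed

lemma pt_eval_cong:
  fixes f g :: "'n::finite \<Rightarrow> ('k::field,'n) site_poly"
  assumes "same_ratio f g" "eval_tuple f x \<noteq> 0" "eval_tuple g x \<noteq> 0"
  shows "pt (eval_tuple f x) = pt (eval_tuple g x)"
  using assms by (simp add: pt_eq_iff_minors same_ratio_value)

lemma pt_eval_scale:
  fixes g :: "'n::finite \<Rightarrow> ('k::field,'n) site_poly"
  assumes g: "multihom_tuple S g" and x: "\<And>i. i \<in> S \<Longrightarrow> x i \<noteq> 0 \<and> y i \<noteq> 0 \<and> pt (y i) = pt (x i)"
    and gx: "eval_tuple g x \<noteq> 0"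
  shows "eval_tuple g y \<noteq> 0 \<and> pt (eval_tuple g y) = pt (eval_tuple g x)"
proof -
  have "\<forall>i. \<exists>c. i \<in> S \<longrightarrow> c \<noteq> 0 \<and> y i = c *s x i" using x pt_eq_iff by metis
  then obtain c where c: "\<And>i. i \<in> S \<Longrightarrow> c i \<noteq> 0 \<and> y i = c i *s x i" by metis
  obtain k where "k \<noteq> 0" "eval_tuple g y = k *s eval_tuple g x"
    by (rule multihom_scale[OF g c])
  moreover from this have "eval_tuple g y \<noteq> 0" using gx by simp
  ultimately show ?thesis using gx pt_eq_iff by blast
qed

text \<open>Using all integers as sites puts the rules of all lattice maps on an equal footing;
  \<open>rational_map_of_eq_ratmap\<close> shows that the maps are the same.\<close>

abbreviation ratmap :: "('n \<Rightarrow> ('k::field,'n::finite) site_poly) \<Rightarrow> ('k,'n) config \<rightharpoonup> ('k,'n) proj" where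
  "ratmap \<equiv> rational_map_of UNIV"

lemma rational_value_at:
  fixes f :: "'n::finite \<Rightarrow> ('k::alg_closed_field,'n) site_poly"
  assumes v: "rational_value S f v q" and x: "coords x v"
  obtains g where "multihom_tuple S g" "same_ratio f g" "eval_tuple g x \<noteq> 0" "q = pt (eval_tuple g x)"
proof -
  obtain g y where g: "multihom_tuple S g" "same_ratio f g" "coords y v"
      "eval_tuple g y \<noteq> 0" "q = pt (eval_tuple g y)"
    using v rational_value_iff by blast
  have "eval_tuple g x \<noteq> 0 \<and> pt (eval_tuple g x) = pt (eval_tuple g y)"
    by (rule pt_eval_scale[OF g(1) _ g(4)]) (use g(3) x in \<open>auto simp: coords_def\<close>)
  then show thesis using that g by metis
qed

lemma rational_value_unique:
  fixes f :: "'n::finite \<Rightarrow> ('k::alg_closed_field,'n) site_poly"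
  assumes f: "nonzero f" and "rational_value S f v q" "rational_value S f v q'"
  shows "q = q'"
proof -
  obtain x where x: "coords x v" using coords_exist by blast
  obtain g where g: "same_ratio f g" "eval_tuple g x \<noteq> 0" "q = pt (eval_tuple g x)"
    using rational_value_at[OF assms(2) x] by blast
  obtain g' where g': "same_ratio f g'" "eval_tuple g' x \<noteq> 0" "q' = pt (eval_tuple g' x)"
    using rational_value_at[OF assms(3) x] by blast
  have "same_ratio g g'" using g(1) g'(1) f same_ratio_sym same_ratio_trans by blast
  then show ?thesis using pt_eval_cong g g' by blast
qed

lemma rational_map_of_eq_Some:
  fixes f :: "'n::finite \<Rightarrow> ('k::alg_closed_field,'n) site_poly"
  assumes f: "nonzero f"
  shows "rational_map_of S f v = Some q \<longleftrightarrow> rational_value S f v q"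
proof -
  have "(THE q. rational_value S f v q) = q" if "rational_value S f v q" for q
    using that rational_value_unique[OF f] by blast
  then show ?thesis unfolding rational_map_of_def by auto
qed

lemma ratmap_at:
  fixes f :: "'n::finite \<Rightarrow> ('k::alg_closed_field,'n) site_poly"
  assumes "multihom g" "same_ratio f g" "nonzero f" "coords x v" "eval_tuple g x \<noteq> 0"
  shows "ratmap f v = Some (pt (eval_tuple g x))"
  using assms by (auto simp: rational_map_of_eq_Some rational_value_iff)

lemma insertion_closed:
  fixes c :: "'a::comm_ring_1 \<Rightarrow> 'r::comm_ring_1" and \<sigma> :: "'u \<Rightarrow> 'r"
  assumes "P 0" "P 1" "\<And>a. P (c a)" "\<And>u. P (\<sigma> u)"
    "\<And>p q. P p \<Longrightarrow> P q \<Longrightarrow> P (p + q)" "\<And>p q. P p \<Longrightarrow> P q \<Longrightarrow> P (p * q)"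
  shows "P (insertion c \<sigma> p)"
proof -
  have power: "P (\<sigma> u ^ n)" for u n by (induction n) (auto intro: assms)
  have "P (\<Prod>u\<in>A. \<sigma> u ^ e u)" for A and e :: "'u \<Rightarrow> nat"
    by (induction A rule: infinite_finite_induct) (auto intro: assms power)
  then have "P (\<Sum>m\<in>A. c (a m) * mono_value \<sigma> m)" for A a
    unfolding mono_value_def by (induction A rule: infinite_finite_induct) (auto intro: assms)
  then show ?thesis by (simp add: insertion_def)
qed

text \<open>Larger sets of sites give no larger domain: the additional variables of a tuple
  that does not vanish at a point can be frozen at the coordinates of that point.\<close>

lemma rational_map_of_eq_ratmap:
  fixes f :: "'n::finite \<Rightarrow> ('k::alg_closed_field,'n) site_poly"
  assumes f: "multihom_tuple S f"
  shows "rational_map_of S f = ratmap f"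
proof -
  have fU: "multihom f" and S: "\<And>j m. m \<in> keys (f j) \<Longrightarrow> keys m \<subseteq> S \<times> UNIV"
    using f multihom_tuple_iff by blast+
  have "rational_value S f v q" if "rational_value UNIV f v q" for v q
  proof -
    obtain g x where g: "multihom g" "same_ratio f g" and x: "coords x v"
        and gx: "eval_tuple g x \<noteq> 0" and q: "q = pt (eval_tuple g x)"
      using \<open>rational_value UNIV f v q\<close> rational_value_iff by blast
    define \<sigma> :: "int \<times> 'n \<Rightarrow> ('k,'n) site_poly" where
      "\<sigma> u = (if fst u \<in> S then variable u else single 0 (x (fst u) $ snd u))" for u
    define p where "p j = subst_poly \<sigma> (g j)" for j
    define mix where "mix y i = (if i \<in> S then y i else x i)" for y and i
    have pv: "value_at (p j) y = value_at (g j) (mix y)" for j y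
    proof -
      have "(\<lambda>u. eval_poly (\<sigma> u) (\<lambda>(i, l). y i $ l)) = (\<lambda>(i, l). mix y i $ l)"
        by (auto simp: \<sigma>_def mix_def)
      then show ?thesis by (simp add: p_def)
    qed
    have fv: "value_at (f j) (mix y) = value_at (f j) y" for j y
      unfolding eval_poly_eq_insertion
      by (rule insertion_cong) (use S in \<open>force simp: mix_def\<close>)
    have "same_ratio p f"
      by (rule same_ratioI_value) (metis pv fv same_ratio_value same_ratio_sym g(2))
    moreover have mix_x: "mix x = x" by (auto simp: mix_def)
    then have px: "eval_tuple p x = eval_tuple g x" by (simp add: vec_eq_iff pv)
    ultimately obtain h where h: "multihom h" "same_ratio h f" "eval_tuple h x \<noteq> 0"
        "\<And>j. keys (h j) \<subseteq> keys (p j)"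
      using multihom_component[OF fU, of p x] gx by metis
    have "\<forall>m\<in>keys (p j). keys m \<subseteq> S \<times> UNIV" for j
      unfolding p_def subst_poly_def
    proof (rule insertion_closed)
      show "\<forall>m\<in>keys (\<sigma> u). keys m \<subseteq> S \<times> UNIV" for u
        by (cases u) (auto simp: \<sigma>_def variable_def)
    next
      fix p q :: "('k,'n) site_poly"
      assume "\<forall>m\<in>keys p. keys m \<subseteq> S \<times> UNIV" "\<forall>m\<in>keys q. keys m \<subseteq> S \<times> UNIV"
      then show "\<forall>m\<in>keys (p + q). keys m \<subseteq> S \<times> UNIV"
        using Poly_Mapping.keys_add[of p q] by blast
    next
      fix p q :: "('k,'n) site_poly"
      assume pq: "\<forall>m\<in>keys p. keys m \<subseteq> S \<times> UNIV" "\<forall>m\<in>keys q. keys m \<subseteq> S \<times> UNIV"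
      show "\<forall>m\<in>keys (p * q). keys m \<subseteq> S \<times> UNIV"
      proof
        fix m assume "m \<in> keys (p * q)"
        then obtain a b where "m = a + b" "a \<in> keys p" "b \<in> keys q" using keys_mult by fastforce
        then show "keys m \<subseteq> S \<times> UNIV" using pq Poly_Mapping.keys_add[of a b] by blast
      qed
    qed auto
    then have "multihom_tuple S h" using h(1,4) by (subst multihom_tuple_iff) blast
    moreover have "same_ratio f h" "same_ratio h g"
      using h(2) g(2) same_ratio_sym same_ratio_trans multihom_nonzero[OF fU] by blast+
    moreover have "q = pt (eval_tuple h x)" using q pt_eval_cong h(3) gx calculation(3) by metis
    ultimately show ?thesis using x h(3) rational_value_iff by blast
  qed
  moreover have "rational_value UNIV f v q" if "rational_value S f v q" for v q
    using that unfolding rational_value_iff by (metis multihom_tuple_iff)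
  ultimately have "rational_value S f = rational_value UNIV f" by (intro ext) blast
  then show ?thesis by (intro ext) (simp add: rational_map_of_def)
qed

text \<open>Agreement on a nonempty open set suffices, as this set is dense.\<close>

lemma same_ratio_if_agree:
  fixes f g :: "'n::finite \<Rightarrow> ('k::alg_closed_field,'n) site_poly"
  assumes P: "finite P" "0 \<notin> P"
    and agree: "\<And>x. (\<And>i. x i \<noteq> 0) \<Longrightarrow> (\<And>p. p \<in> P \<Longrightarrow> value_at p x \<noteq> 0) \<Longrightarrow>
      eval_tuple f x \<noteq> 0 \<Longrightarrow> eval_tuple g x \<noteq> 0 \<Longrightarrow> pt (eval_tuple f x) = pt (eval_tuple g x)"
  shows "same_ratio f g"
  unfolding same_ratio_def
proof (intro allI, rule ccontr)
  fix i j assume "f i * g j \<noteq> f j * g i"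
  then have "0 \<notin> insert (f i * g j - f j * g i) P" using P by auto
  moreover have "finite (insert (f i * g j - f j * g i) P)" using P by simp
  ultimately obtain x where x: "\<And>i. x i \<noteq> 0"
      "\<And>p. p \<in> insert (f i * g j - f j * g i) P \<Longrightarrow> value_at p x \<noteq> 0"
    using common_nonzero_vectors by metis
  then have ne: "eval_tuple f x $ i * eval_tuple g x $ j \<noteq> eval_tuple f x $ j * eval_tuple g x $ i"
    using x(2)[of "f i * g j - f j * g i"] by (simp add: eval_poly.hom_minus eval_poly.hom_mult)
  then have "eval_tuple f x \<noteq> 0" "eval_tuple g x \<noteq> 0" by (auto simp del: eval_tuple_nth)
  then show False using agree x ne pt_eq_iff_minors by blast
qed

lemma ratmap_eq_iff:
  fixes f g :: "'n::finite \<Rightarrow> ('k::alg_closed_field,'n) site_poly"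
  assumes f: "multihom f" and g: "multihom g"
  shows "ratmap f = ratmap g \<longleftrightarrow> same_ratio f g"
proof
  assume eq: "ratmap f = ratmap g"
  show "same_ratio f g"
  proof (rule same_ratio_if_agree[of "{}"])
    fix x assume x: "\<And>i. x i \<noteq> 0" and fx: "eval_tuple f x \<noteq> 0" and gx: "eval_tuple g x \<noteq> 0"
    have "coords x (\<lambda>i. pt (x i))" using x by (simp add: coords_def)
    then show "pt (eval_tuple f x) = pt (eval_tuple g x)"
      using ratmap_at[of f f] ratmap_at[of g g] f g fx gx eq multihom_nonzero
      by (metis option.inject same_ratio_refl)
  qed auto
next
  assume fg: "same_ratio f g"
  have "same_ratio f h \<longleftrightarrow> same_ratio g h" for h
    using fg same_ratio_trans same_ratio_sym multihom_nonzero f g by blast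
  then have "rational_value UNIV f = rational_value UNIV g"
    by (simp add: rational_value_iff fun_eq_iff)
  then show "ratmap f = ratmap g" by (intro ext) (simp add: rational_map_of_def)
qed

section \<open>Composition of tuples and of lattice maps\<close>

definition shift_poly :: "int \<Rightarrow> ('k::comm_ring_1,'n) site_poly \<Rightarrow> ('k,'n) site_poly" where
  "shift_poly i = subst_poly (\<lambda>(s, l). variable (i + s, l))"

definition tuple_comp ::
  "('n \<Rightarrow> ('k::field,'n::finite) site_poly) \<Rightarrow> ('n \<Rightarrow> ('k,'n) site_poly) \<Rightarrow> 'n \<Rightarrow> ('k,'n) site_poly" where
  "tuple_comp g f j = subst_poly (\<lambda>(i, l). shift_poly i (f l)) (g j)"

lemma value_subst_poly:
  assumes "\<And>i l. value_at (\<sigma> (i, l)) x = y i $ l"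
  shows "value_at (subst_poly \<sigma> p) x = value_at p y"
proof -
  have "(\<lambda>u. value_at (\<sigma> u) x) = (\<lambda>(i, l). y i $ l)" using assms by auto
  then show ?thesis by simp
qed

lemma value_shift_poly [simp]: "value_at (shift_poly i p) x = value_at p (shift i x)"
  unfolding shift_poly_def by (rule value_subst_poly) (simp add: shift_def)

lemma value_tuple_comp: "value_at (tuple_comp g f j) x = value_at (g j) (\<lambda>i. eval_tuple f (shift i x))"
  unfolding tuple_comp_def by (rule value_subst_poly) simp

lemma eval_tuple_comp: "eval_tuple (tuple_comp g f) x = eval_tuple g (\<lambda>i. eval_tuple f (shift i x))"
  by (simp add: vec_eq_iff value_tuple_comp)

lemma tuple_comp_assoc:
  fixes h :: "'n::finite \<Rightarrow> ('k::alg_closed_field,'n) site_poly"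
  shows "tuple_comp (tuple_comp k g) h = tuple_comp k (tuple_comp g h)"
proof (rule ext, rule site_poly_eqI)
  fix j and x :: "int \<Rightarrow> 'k ^ 'n"
  have "shift i (\<lambda>i. eval_tuple h (shift i x)) = (\<lambda>s. eval_tuple h (shift s (shift i x)))" for i
    by (simp add: shift_def add.assoc)
  then show "value_at (tuple_comp (tuple_comp k g) h j) x = value_at (tuple_comp k (tuple_comp g h) j) x"
    by (simp add: value_tuple_comp eval_tuple_comp del: eval_tuple_nth)
qed

lemma shift_poly_nonzero:
  fixes p :: "('k::alg_closed_field,'n::finite) site_poly"
  assumes "p \<noteq> 0" shows "shift_poly i p \<noteq> 0"
proof
  assume 0: "shift_poly i p = 0"
  have "value_at p x = 0" for x
  proof -
    have "shift i (\<lambda>s. x (s - i)) = x" by (simp add: shift_def)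
    then have "value_at p x = value_at (shift_poly i p) (\<lambda>s. x (s - i))" by simp
    then show ?thesis by (simp add: 0 eval_poly.hom_zero)
  qed
  then have "p = 0" by (intro site_poly_eqI) (simp add: eval_poly.hom_zero)
  then show False using assms by simp
qed

lemma coords_shift: "coords x v \<Longrightarrow> coords (shift i x) (shift i v)"
  by (simp add: coords_def shift_def)

lemma eval_tuple_nonzero: "value_at (f l) x \<noteq> 0 \<Longrightarrow> eval_tuple f x \<noteq> 0"
  by (auto simp: eval_tuple_eq_0_iff)

lemma tuple_comp_left:
  fixes f g g' :: "'n::finite \<Rightarrow> ('k::alg_closed_field,'n) site_poly"
  assumes "same_ratio g g'" shows "same_ratio (tuple_comp g f) (tuple_comp g' f)"
  by (rule same_ratioI_value) (unfold value_tuple_comp, rule same_ratio_value[OF assms])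

text \<open>At a general point of the source the two inner tuples give nonzero vectors on the same line,
  at each of the finitely many sites on which \<open>k\<close> depends, and \<open>k\<close> is multihomogeneous.\<close>

lemma tuple_comp_right:
  fixes f f' k :: "'n::finite \<Rightarrow> ('k::alg_closed_field,'n) site_poly"
  assumes k: "multihom k" and ff': "same_ratio f f'" and f: "nonzero f" and f': "nonzero f'"
    and kf: "nonzero (tuple_comp k f)"
  shows "nonzero (tuple_comp k f')" "same_ratio (tuple_comp k f) (tuple_comp k f')"
proof -
  obtain S where S: "finite S" "multihom_tuple S k" using multihom_finite_sites[OF k] by metis
  obtain l l' where l: "f l \<noteq> 0" "f' l' \<noteq> 0" using f f' by blast
  define P where "P = (\<lambda>i. shift_poly i (f l)) ` S \<union> (\<lambda>i. shift_poly i (f' l')) ` S"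
  have P: "finite P" "0 \<notin> P" using S l by (auto simp: P_def dest: shift_poly_nonzero[THEN not_sym])
  have key: "eval_tuple (tuple_comp k f') x \<noteq> 0 \<and>
      pt (eval_tuple (tuple_comp k f') x) = pt (eval_tuple (tuple_comp k f) x)"
    if x: "\<And>p. p \<in> P \<Longrightarrow> value_at p x \<noteq> 0" and kfx: "eval_tuple (tuple_comp k f) x \<noteq> 0" for x
    unfolding eval_tuple_comp
  proof (rule pt_eval_scale[OF S(2)])
    fix i assume i: "i \<in> S"
    have "value_at (f l) (shift i x) \<noteq> 0" "value_at (f' l') (shift i x) \<noteq> 0"
      using x[of "shift_poly i (f l)"] x[of "shift_poly i (f' l')"] i by (auto simp: P_def)
    then have "eval_tuple f (shift i x) \<noteq> 0" "eval_tuple f' (shift i x) \<noteq> 0"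
      by (auto simp: eval_tuple_eq_0_iff)
    then show "eval_tuple f (shift i x) \<noteq> 0 \<and> eval_tuple f' (shift i x) \<noteq> 0 \<and>
        pt (eval_tuple f' (shift i x)) = pt (eval_tuple f (shift i x))"
      using pt_eval_cong[OF ff'] by auto
  qed (use kfx eval_tuple_comp in metis)
  obtain j where j: "tuple_comp k f j \<noteq> 0" using kf by blast
  then have "finite (insert (tuple_comp k f j) P)" "0 \<notin> insert (tuple_comp k f j) P"
    using P by auto
  then obtain x where "\<And>p. p \<in> insert (tuple_comp k f j) P \<Longrightarrow> value_at p x \<noteq> 0"
    using common_nonzero_vectors by metis
  then show "nonzero (tuple_comp k f')"
    using key eval_tuple_nonzero[of "tuple_comp k f" j x] nonzero_if_eval by blast
  show "same_ratio (tuple_comp k f) (tuple_comp k f')"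
    by (rule same_ratio_if_agree[OF P]) (metis key)
qed

definition represents ::
  "('n \<Rightarrow> ('k::field,'n::finite) site_poly) \<Rightarrow> ('k,'n) lattice_map \<Rightarrow> bool" where
  "represents f T \<longleftrightarrow> multihom f \<and> T = lattice_map_of (ratmap f)"

lemma lattice_map_of_at_0: "lattice_map_of \<phi> v 0 = \<phi> v"
  by (simp add: lattice_map_of_def shift_def)

lemma local_rule_represents:
  fixes T :: "('k::alg_closed_field,'n::finite) lattice_map"
  assumes "local_rule S \<phi> T"
  obtains f where "multihom_tuple S f" "\<phi> = rational_map_of S f" "represents f T"
  using assms unfolding local_rule_def rational_map_def represents_def
  by (metis multihom_tuple_iff rational_map_of_eq_ratmap)

lemma local_rule_unique:
  assumes "local_rule S \<phi> T" "represents f T"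
  shows "\<phi> = ratmap f"
proof
  fix v
  show "\<phi> v = ratmap f v"
    using assms lattice_map_of_at_0[of \<phi> v] lattice_map_of_at_0[of "ratmap f" v]
    unfolding local_rule_def represents_def by metis
qed

lemma represents_same_ratio:
  fixes f g :: "'n::finite \<Rightarrow> ('k::alg_closed_field,'n) site_poly"
  assumes "represents f T" "represents g T" shows "same_ratio f g"
proof -
  have "ratmap f v = ratmap g v" for v
    using assms lattice_map_of_at_0[of "ratmap f" v] lattice_map_of_at_0[of "ratmap g" v]
    unfolding represents_def by metis
  then show ?thesis using assms ratmap_eq_iff unfolding represents_def by blast
qed

lemma represents_cong:
  fixes f g :: "'n::finite \<Rightarrow> ('k::alg_closed_field,'n) site_poly"
  assumes "represents f T" "same_ratio f g" "multihom g" shows "represents g T"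
  using assms ratmap_eq_iff unfolding represents_def by metis

lemma represents_local_rule:
  fixes f :: "'n::finite \<Rightarrow> ('k::alg_closed_field,'n) site_poly"
  assumes "represents f T"
  obtains S where "multihom_tuple S f" "local_rule S (rational_map_of S f) T"
proof -
  obtain S where S: "finite S" "0 \<in> S" "multihom_tuple S f"
    using assms multihom_finite_sites unfolding represents_def by blast
  moreover have "local_rule S (rational_map_of S f) T"
    using S assms rational_map_of_eq_ratmap[OF S(3)]
    by (auto simp: local_rule_def rational_map_def represents_def)
  ultimately show thesis using that by blast
qed

text \<open>At a general point all tuples can be evaluated, so the composite of tuples computes the
  composition wherever both are defined. Only the outer tuple cannot be prescribed: of the many
  tuples \<open>g\<close> for \<open>T'\<close>, one is needed that does not vanish identically on the image of \<open>T\<close>. It comes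
  from a point where the composition is defined.\<close>

lemma lattice_comp_tuple:
  fixes f f' h :: "'n::finite \<Rightarrow> ('k::alg_closed_field,'n) site_poly"
  assumes comp: "lattice_comp T' T U"
    and T: "represents f T" and T': "represents f' T'" and U: "represents h U"
  obtains g where "multihom g" "same_ratio f' g" "nonzero (tuple_comp g f)"
    "same_ratio h (tuple_comp g f)"
proof -
  have f: "multihom f" and f': "multihom f'" and h: "multihom h"
    using T T' U by (auto simp: represents_def)
  obtain S \<phi> S' \<phi>' \<psi> where loc: "local_rule S \<phi> T" "local_rule S' \<phi>' T'" "local_rule (S + S') \<psi> U"
    and dom: "\<not> ran (regional_map \<phi> S') \<subseteq> Ind \<phi>'"
    and agree: "\<And>v w. regional_map \<phi> S' v = Some w \<Longrightarrow> w \<in> dom \<phi>' \<Longrightarrow> \<psi> v = \<phi>' w"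
    using comp unfolding lattice_comp_def by blast
  have \<phi>: "\<phi> = ratmap f" and \<phi>': "\<phi>' = ratmap f'" and \<psi>: "\<psi> = ratmap h"
    using local_rule_unique loc T T' U by metis+
  have S': "finite S'" using loc(2) by (simp add: local_rule_def)
  obtain f1 where f1: "multihom_tuple S' f1" "\<phi>' = rational_map_of S' f1" "represents f1 T'"
    by (rule local_rule_represents[OF loc(2)])
  have f1': "same_ratio f' f1" using represents_same_ratio[OF T' f1(3)] .
  obtain v w where vw: "regional_map \<phi> S' v = Some w" "w \<in> dom \<phi>'"
    using dom by (auto simp: ran_def Ind_def)
  obtain x where x: "coords x v" using coords_exist by blast
  obtain y where y: "coords y w" using coords_exist by blast
  obtain q where "\<phi>' w = Some q" using vw(2) by auto
  then have q: "rational_value S' f1 w q"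
    using rational_map_of_eq_Some f1(2) multihom_nonzero f1(3) unfolding represents_def by metis
  obtain g where g: "multihom_tuple S' g" "same_ratio f1 g" "eval_tuple g y \<noteq> 0"
    by (rule rational_value_at[OF q y])
  have gU: "multihom g" using g(1) multihom_tuple_iff by blast
  have "nonzero f1" using f1(3) multihom_nonzero unfolding represents_def by blast
  then have f'g: "same_ratio f' g" using f1' g(2) same_ratio_trans by blast
  \<comment> \<open>The tuples that compute the image of \<open>v\<close> may differ from site to site.\<close>
  have "\<exists>G. multihom G \<and> same_ratio f G \<and> eval_tuple G (shift i x) \<noteq> 0 \<and>
      w i = pt (eval_tuple G (shift i x))" if i: "i \<in> S'" for i
  proof -
    have "ratmap f (shift i v) = Some (w i)"
      using vw(1) i unfolding regional_map_def \<phi> by (auto split: if_splits)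
    then have "rational_value UNIV f (shift i v) (w i)"
      using rational_map_of_eq_Some multihom_nonzero[OF f] by metis
    then show ?thesis using rational_value_at[OF _ coords_shift[OF x]] by metis
  qed
  then obtain G where G: "\<And>i. i \<in> S' \<Longrightarrow> multihom (G i) \<and> same_ratio f (G i) \<and>
      eval_tuple (G i) (shift i x) \<noteq> 0 \<and> w i = pt (eval_tuple (G i) (shift i x))"
    by metis
  define p where "p j = subst_poly (\<lambda>(i, l). if i \<in> S' then shift_poly i (G i l)
      else single 0 (y i $ l)) (g j)" for j
  define X where "X z i = (if i \<in> S' then eval_tuple (G i) (shift i z) else y i)" for z i
  have pX: "eval_tuple p z = eval_tuple g (X z)" for z
  proof -
    have "value_at (p j) z = value_at (g j) (X z)" for j
      unfolding p_def by (rule value_subst_poly) (simp add: X_def)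
    then show ?thesis by (simp add: vec_eq_iff)
  qed
  have "eval_tuple g (X x) \<noteq> 0"
    using pt_eval_scale[OF g(1), of y "X x"] g(3) G y by (auto simp: X_def coords_def)
  then have "nonzero p" unfolding pX[symmetric] by (rule nonzero_if_eval)
  then obtain j where j: "p j \<noteq> 0" by blast
  obtain l where l: "f l \<noteq> 0" using multihom_nonzero[OF f] by blast
  have "\<exists>l. i \<in> S' \<longrightarrow> G i l \<noteq> 0" for i using G multihom_nonzero by blast
  then obtain l' where l': "\<And>i. i \<in> S' \<Longrightarrow> G i (l' i) \<noteq> 0" by metis
  define F where "F = (\<lambda>i. shift_poly i (f l)) ` S'"
  have F: "finite F" "0 \<notin> F" using S' l by (auto simp: F_def dest: shift_poly_nonzero[THEN not_sym])
  have Fx: "eval_tuple f (shift i z) \<noteq> 0"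
    if "\<And>p. p \<in> F \<Longrightarrow> value_at p z \<noteq> 0" "i \<in> S'" for z i
    using that(1)[of "shift_poly i (f l)"] that(2) by (auto simp: F_def eval_tuple_eq_0_iff)
  define P where "P = insert (p j) ((\<lambda>i. shift_poly i (G i (l' i))) ` S' \<union> F)"
  have "finite P" "0 \<notin> P"
    using S' j F l' by (auto simp: P_def dest: shift_poly_nonzero[THEN not_sym])
  then obtain z where z: "\<And>p. p \<in> P \<Longrightarrow> value_at p z \<noteq> 0"
    using common_nonzero_vectors by metis
  have "eval_tuple (tuple_comp g f) z \<noteq> 0"
    unfolding eval_tuple_comp
  proof (rule conjunct1[OF pt_eval_scale[OF g(1), of "X z"]])
    show "eval_tuple g (X z) \<noteq> 0"
      unfolding pX[symmetric] using z[of "p j"] by (auto simp: P_def eval_tuple_eq_0_iff)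
    fix i assume i: "i \<in> S'"
    have "eval_tuple (G i) (shift i z) \<noteq> 0"
      using z[of "shift_poly i (G i (l' i))"] i by (auto simp: P_def eval_tuple_eq_0_iff)
    moreover have "eval_tuple f (shift i z) \<noteq> 0" using Fx z i by (simp add: P_def)
    ultimately show "X z i \<noteq> 0 \<and> eval_tuple f (shift i z) \<noteq> 0 \<and> pt (eval_tuple f (shift i z)) = pt (X z i)"
      using pt_eval_cong[of f "G i" "shift i z"] G[OF i] i by (simp add: X_def)
  qed
  then have nz: "nonzero (tuple_comp g f)" by (rule nonzero_if_eval)
  have "same_ratio h (tuple_comp g f)"
  proof (rule same_ratio_if_agree[OF F])
    fix x assume x0: "\<And>i. x i \<noteq> 0" and xF: "\<And>p. p \<in> F \<Longrightarrow> value_at p x \<noteq> 0"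
      and hx: "eval_tuple h x \<noteq> 0" and gfx: "eval_tuple (tuple_comp g f) x \<noteq> 0"
    define v where "v i = pt (x i)" for i
    have xv: "coords x v" using x0 by (simp add: coords_def v_def)
    define w where "w = (\<lambda>i\<in>S'. pt (eval_tuple f (shift i x)))"
    have fx: "ratmap f (shift i v) = Some (pt (eval_tuple f (shift i x)))" if "i \<in> S'" for i
      by (rule ratmap_at) (use f multihom_nonzero xv coords_shift Fx xF that in auto)
    have reg: "regional_map \<phi> S' v = Some w"
      unfolding regional_map_def \<phi> w_def using fx by (auto simp: restrict_def fun_eq_iff)
    obtain y where y: "coords y w" using coords_exist by blast
    define Y where "Y i = (if i \<in> S' then eval_tuple f (shift i x) else y i)" for i
    have "w i = pt (eval_tuple f (shift i x))" if "i \<in> S'" for i using that by (simp add: w_def)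
    then have Y: "coords Y w" using y Fx[OF xF] unfolding coords_def Y_def by metis
    have gY: "eval_tuple g Y \<noteq> 0 \<and> pt (eval_tuple g Y) = pt (eval_tuple (tuple_comp g f) x)"
      unfolding eval_tuple_comp
      by (rule pt_eval_scale[OF g(1)]) (use Fx[OF xF] gfx in \<open>auto simp: Y_def eval_tuple_comp\<close>)
    have "\<phi>' w = Some (pt (eval_tuple g Y))"
      unfolding \<phi>' by (rule ratmap_at[OF gU f'g]) (use f' multihom_nonzero Y gY in auto)
    moreover have "\<psi> v = Some (pt (eval_tuple h x))"
      unfolding \<psi> by (rule ratmap_at[OF h]) (use h multihom_nonzero xv hx in auto)
    moreover have "\<psi> v = \<phi>' w" using agree[OF reg] calculation(1) by blast
    ultimately show "pt (eval_tuple h x) = pt (eval_tuple (tuple_comp g f) x)" using gY by simp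
  qed
  then show thesis using that gU f'g nz by blast
qed

lemma lattice_comp_represented:
  fixes T :: "('k::alg_closed_field,'n::finite) lattice_map"
  assumes "lattice_comp T' T U"
  obtains f f' h where "represents f T" "represents f' T'" "represents h U"
  using assms unfolding lattice_comp_def by (metis local_rule_represents)

lemma lattice_comp_unique:
  fixes T :: "('k::alg_closed_field,'n::finite) lattice_map"
  assumes U: "lattice_comp T' T U" and V: "lattice_comp T' T V"
  shows "U = V"
proof -
  obtain f f' h where r: "represents f T" "represents f' T'" "represents h U"
    by (rule lattice_comp_represented[OF U])
  obtain h' where h': "represents h' V" by (rule lattice_comp_represented[OF V])
  obtain g where g: "same_ratio f' g" "nonzero (tuple_comp g f)" "same_ratio h (tuple_comp g f)"
    by (rule lattice_comp_tuple[OF U r])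
  obtain g' where g': "same_ratio f' g'" "nonzero (tuple_comp g' f)" "same_ratio h' (tuple_comp g' f)"
    by (rule lattice_comp_tuple[OF V r(1,2) h'])
  have "nonzero f'" using r(2) multihom_nonzero unfolding represents_def by blast
  then have "same_ratio g g'" using g(1) g'(1) same_ratio_sym same_ratio_trans by blast
  then have "same_ratio (tuple_comp g f) (tuple_comp g' f)" by (rule tuple_comp_left)
  then have "same_ratio h (tuple_comp g' f)" using g same_ratio_trans by blast
  then have "same_ratio h h'" using g' same_ratio_sym same_ratio_trans by blast
  then have "represents h' U" using represents_cong[OF r(3)] h' by (auto simp: represents_def)
  then show ?thesis using h' by (simp add: represents_def)
qed

section \<open>Degrees\<close>

text \<open>The existence of a tuple without common factor is part of the claim: among the tuples
  that represent \<open>T\<close>, one of least degree is such.\<close>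

lemma lattice_degree_exists:
  fixes f :: "'n::finite \<Rightarrow> ('k::alg_closed_field,'n) site_poly"
  assumes f: "represents f T"
  shows "lattice_degree T \<le> tuple_degree f" "\<exists>g. represents g T \<and> tuple_degree g = lattice_degree T"
proof -
  define Q where "Q n \<longleftrightarrow> (\<exists>S f. multihom_tuple S f \<and> no_common_factor f \<and>
        local_rule S (rational_map_of S f) T \<and> n = tuple_degree f)" for n
  have deg: "lattice_degree T = (LEAST n. Q n)" by (simp add: lattice_degree_def Q_def)
  have "multihom f \<and> same_ratio f f" using f by (simp add: represents_def)
  then obtain g where g: "multihom g" "same_ratio f g"
      and least: "\<And>g'. multihom g' \<and> same_ratio f g' \<Longrightarrow> tuple_degree g \<le> tuple_degree g'"
    using ex_has_least_nat[of "\<lambda>g. multihom g \<and> same_ratio f g" f tuple_degree] by metis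
  have gT: "represents g T" using represents_cong[OF f g(2,1)] .
  have "no_common_factor g"
  proof (rule coprime_if_least_degree[OF g(1)])
    fix g' assume g': "multihom g'" "same_ratio g' g"
    then have "same_ratio f g'" using g same_ratio_sym same_ratio_trans multihom_nonzero by blast
    then show "tuple_degree g \<le> tuple_degree g'" using least g' by blast
  qed
  moreover obtain S where "multihom_tuple S g" "local_rule S (rational_map_of S g) T"
    by (rule represents_local_rule[OF gT])
  ultimately have Qg: "Q (tuple_degree g)" unfolding Q_def by blast
  have "lattice_degree T \<le> tuple_degree g" unfolding deg by (rule Least_le[of Q, OF Qg])
  also have "\<dots> \<le> tuple_degree f" using least f by (simp add: represents_def)
  finally show "lattice_degree T \<le> tuple_degree f" .
  have "Q (lattice_degree T)" unfolding deg by (rule LeastI[of Q, OF Qg])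
  then obtain S h where h: "multihom_tuple S h" "local_rule S (rational_map_of S h) T"
      "lattice_degree T = tuple_degree h" unfolding Q_def by blast
  have "represents h T"
    using h(1,2) rational_map_of_eq_ratmap[OF h(1)] multihom_tuple_iff
    by (auto simp: represents_def local_rule_def)
  then show "\<exists>g. represents g T \<and> tuple_degree g = lattice_degree T" using h(3) by metis
qed

text \<open>A ring with a degree filtration \<open>D\<close> stands for the polynomials themselves, and also for the
  polynomials in one parameter over them that occur in \<open>tuple_comp_degree\<close>.\<close>

lemma insertion_filtered:
  fixes c :: "'a::comm_ring_1 \<Rightarrow> 'r::comm_ring_1" and \<sigma> :: "'u \<Rightarrow> 'r" and D :: "nat \<Rightarrow> 'r \<Rightarrow> bool"
  assumes zero: "D 0 0" and one: "D 0 1" and c: "\<And>a. D 0 (c a)" and \<sigma>: "\<And>u. D d (\<sigma> u)"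
    and mono: "\<And>m n p. D m p \<Longrightarrow> m \<le> n \<Longrightarrow> D n p"
    and add: "\<And>n p q. D n p \<Longrightarrow> D n q \<Longrightarrow> D n (p + q)"
    and mult: "\<And>m n p q. D m p \<Longrightarrow> D n q \<Longrightarrow> D (m + n) (p * q)"
    and p: "\<And>m. m \<in> keys p \<Longrightarrow> total_degree m \<le> N"
  shows "D (N * d) (insertion c \<sigma> p)"
proof -
  have power: "D (n * d) (\<sigma> u ^ n)" for u n
    by (induction n) (auto intro: one mult \<sigma>)
  have prod: "D ((\<Sum>u\<in>A. e u) * d) (\<Prod>u\<in>A. \<sigma> u ^ e u)" for A and e :: "'u \<Rightarrow> nat"
    by (induction A rule: infinite_finite_induct) (auto simp: distrib_right intro: one mult power)
  have term_bound: "D (N * d) (c (lookup p m) * mono_value \<sigma> m)" if "m \<in> keys p" for m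
  proof -
    have "D (0 + total_degree m * d) (c (lookup p m) * mono_value \<sigma> m)"
      unfolding mono_value_def total_degree_def by (intro mult c prod)
    then show ?thesis by (rule mono) (use p[OF that] in simp)
  qed
  have "D (N * d) (\<Sum>m\<in>A. c (lookup p m) * mono_value \<sigma> m)" if "A \<subseteq> keys p" for A
    using that by (induction A rule: infinite_finite_induct)
      (auto intro: add term_bound mono[OF zero])
  then show ?thesis by (simp add: insertion_def)
qed

definition degree_le :: "nat \<Rightarrow> (('u \<Rightarrow>\<^sub>0 nat) \<Rightarrow>\<^sub>0 'k::comm_ring_1) \<Rightarrow> bool" where
  "degree_le n p \<longleftrightarrow> (\<forall>m\<in>keys p. total_degree m \<le> n)"

lemma degree_le_add: "degree_le n p \<Longrightarrow> degree_le n q \<Longrightarrow> degree_le n (p + q)"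
  unfolding degree_le_def using Poly_Mapping.keys_add[of p q] by blast

lemma degree_le_minus: "degree_le n p \<Longrightarrow> degree_le n q \<Longrightarrow> degree_le n (p - q)"
  unfolding degree_le_def using keys_diff[of p q] by blast

lemma degree_le_sum: "(\<And>x. x \<in> A \<Longrightarrow> degree_le n (f x)) \<Longrightarrow> degree_le n (\<Sum>x\<in>A. f x)"
  by (induction A rule: infinite_finite_induct) (auto intro: degree_le_add simp: degree_le_def[of _ 0])

lemma degree_le_mult:
  assumes "degree_le m p" "degree_le n q" shows "degree_le (m + n) (p * q)"
  unfolding degree_le_def
proof
  fix k assume "k \<in> keys (p * q)"
  then obtain a b where "k = a + b" "a \<in> keys p" "b \<in> keys q" using keys_mult by fastforce
  then show "total_degree k \<le> m + n"
    using assms by (auto simp: degree_le_def total_degree_add intro: add_mono)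
qed

lemma degree_le_const: "degree_le 0 (single 0 a)"
  by (auto simp: degree_le_def)

lemma degree_le_shift_poly:
  fixes p :: "('k::comm_ring_1,'n) site_poly"
  assumes "degree_le n p" shows "degree_le n (shift_poly i p)"
proof -
  have "degree_le (n * 1) (shift_poly i p)"
    unfolding shift_poly_def subst_poly_def
  proof (rule insertion_filtered)
    show "degree_le 1 (case u of (s, l) \<Rightarrow> variable (i + s, l))" for u
      by (cases u) (simp add: degree_le_def variable_def)
    show "degree_le n q" if "degree_le m q" "m \<le> n" for m n and q :: "('k,'n) site_poly"
      using that by (auto simp: degree_le_def intro: order_trans)
  qed (use assms in \<open>auto simp: degree_le_add degree_le_mult degree_le_const degree_le_def[of _ p] degree_le_def[of _ 0] degree_le_def[of _ 1]\<close>)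
  then show ?thesis by simp
qed

lemma coeff_mult_lowest:
  fixes p q :: "'r::comm_semiring_0 poly"
  assumes "\<And>i. i < k \<Longrightarrow> coeff p i = 0"
  shows "coeff (p * q) k = coeff p k * coeff q 0"
proof -
  have "coeff (p * q) k = (\<Sum>i\<le>k. coeff p i * coeff q (k - i))" by (rule coeff_mult)
  also have "\<dots> = (\<Sum>i\<in>{k}. coeff p i * coeff q (k - i))"
    by (rule sum.mono_neutral_right) (use assms in auto)
  finally show ?thesis by simp
qed

text \<open>If \<open>f'\<close> vanishes on the image of \<open>f\<close>, the composite of tuples is useless. Then move the
  argument of \<open>f'\<close> off the image along a line with parameter \<open>t\<close>: the lowest
  nonzero coefficient in \<open>t\<close> has the ratios of the composition, and its degree is at most
  the product of the degrees.\<close>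

lemma tuple_comp_degree:
  fixes f f' g h :: "'n::finite \<Rightarrow> ('k::alg_closed_field,'n) site_poly"
  assumes f': "multihom f'" and h: "multihom h" and f'g: "same_ratio f' g"
    and nz: "nonzero (tuple_comp g f)" and hgf: "same_ratio h (tuple_comp g f)"
  obtains h' where "multihom h'" "same_ratio h h'" "tuple_degree h' \<le> tuple_degree f' * tuple_degree f"
proof -
  obtain w where w: "eval_tuple f' w \<noteq> 0" using nonzero_eval[OF multihom_nonzero[OF f']] by metis
  define F where "F = (\<lambda>(i, l). shift_poly i (f l))"
  define y where "y = (\<lambda>(i, l). w i $ l - value_at (F (i, l)) (\<lambda>_. 0))"
  define c :: "'k \<Rightarrow> ('k,'n) site_poly poly" where "c a = [:single 0 a:]" for a
  define \<tau> where "\<tau> u = [:F u, single 0 (y u):]" for u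
  interpret c: ring_homomorphism c
    by unfold_locales (auto simp: c_def single_add mult_single mult.commute)
  define A where "A j = insertion c \<tau> (f' j)" for j
  define B where "B j = insertion c \<tau> (g j)" for j
  have AB: "A i * B j = A j * B i" for i j
    using f'g by (simp add: A_def B_def c.insertion_mult[symmetric] same_ratio_def)
  have at: "poly (insertion c \<tau> p) t = subst_poly (\<lambda>u. F u + t * single 0 (y u)) p" for p t
  proof -
    interpret ev_t: ring_homomorphism "\<lambda>P::('k,'n) site_poly poly. poly P t"
      by unfold_locales auto
    show ?thesis
      unfolding ev_t.hom_insertion by (simp add: subst_poly_def c_def \<tau>_def)
  qed
  \<comment> \<open>At \<open>t = 0\<close> nothing is moved; at \<open>t = 1\<close> the image of the zero vector is moved to \<open>w\<close>, where
    \<open>f'\<close> does not vanish. This is the reason for the choice of \<open>y\<close>.\<close>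
  have B0: "coeff (B j) 0 = tuple_comp g f j" for j
    using at[of "g j" 0] by (simp add: B_def poly_0_coeff_0 tuple_comp_def F_def)
  obtain j0 where j0: "value_at (f' j0) w \<noteq> 0" using w by (auto simp: eval_tuple_eq_0_iff)
  have "value_at (poly (A j0) 1) (\<lambda>_. 0) = value_at (f' j0) w"
  proof -
    have "(\<lambda>u. value_at (F u + single 0 (y u)) (\<lambda>_. 0)) = (\<lambda>(i, l). w i $ l)"
      by (auto simp: y_def eval_poly.hom_add)
    then show ?thesis by (simp add: A_def at)
  qed
  then have "A j0 \<noteq> 0" using j0 by (auto simp: eval_poly.hom_zero)
  then have ex: "\<exists>k j. coeff (A j) k \<noteq> 0" by (metis leading_coeff_0_iff)
  define k where "k = (LEAST k. \<exists>j. coeff (A j) k \<noteq> 0)"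
  have k: "\<exists>j. coeff (A j) k \<noteq> 0" unfolding k_def using ex by (rule LeastI_ex)
  have low: "coeff (A j) i = 0" if "i < k" for i j using not_less_Least that unfolding k_def by blast
  define p where "p j = coeff (A j) k" for j
  have "p i * tuple_comp g f j = p j * tuple_comp g f i" for i j
    using coeff_mult_lowest[of k "A i" "B j", OF low] coeff_mult_lowest[of k "A j" "B i", OF low]
    by (simp add: AB[of i j] p_def B0)
  then have "same_ratio p (tuple_comp g f)" by (simp add: same_ratio_def)
  then have ph: "same_ratio p h" using hgf nz same_ratio_sym same_ratio_trans by blast
  obtain x where x: "eval_tuple p x \<noteq> 0" using nonzero_eval[of p] k by (auto simp: p_def)
  obtain h' where h': "multihom h'" "same_ratio h' h" "\<And>j. keys (h' j) \<subseteq> keys (p j)"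
    using multihom_component[OF h ph x] by metis
  \<comment> \<open>The degree counts the variables at the sites; the parameter \<open>t\<close> has degree 0.\<close>
  define D where "D n P \<longleftrightarrow> (\<forall>k. degree_le n (coeff P k))" for n and P :: "('k,'n) site_poly poly"
  have f_le: "degree_le (tuple_degree f) (f l)" for l
    using total_degree_le_tuple_degree by (auto simp: degree_le_def)
  have "D (tuple_degree f' * tuple_degree f) (A j)" for j
    unfolding A_def
  proof (rule insertion_filtered)
    show "D 0 0" "D 0 1" by (auto simp: D_def degree_le_def coeff_1 split: if_splits)
    show "D 0 (c a)" for a
      by (auto simp: D_def c_def coeff_pCons degree_le_def split: nat.splits)
    show "D (tuple_degree f) (\<tau> u)" for u
    proof -
      have "degree_le (tuple_degree f) (F u)"
        using f_le by (cases u) (simp add: F_def degree_le_shift_poly)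
      then show ?thesis
        by (auto simp: D_def \<tau>_def coeff_pCons degree_le_def split: nat.splits)
    qed
    show "D n p" if "D m p" "m \<le> n" for m n p
      using that by (auto simp: D_def degree_le_def intro: order_trans)
    show "D n (p + q)" if "D n p" "D n q" for n p q
      using that by (simp add: D_def degree_le_add)
    show "D (m + n) (p * q)" if "D m p" "D n q" for m n p q
      using that by (auto simp: D_def coeff_mult intro: degree_le_sum degree_le_mult)
    show "total_degree m \<le> tuple_degree f'" if "m \<in> keys (f' j)" for m
      by (rule total_degree_le_tuple_degree[of m f' j, OF that])
  qed
  then have "total_degree m \<le> tuple_degree f' * tuple_degree f" if "m \<in> keys (h' j)" for j m
    using that h'(3) by (force simp: D_def p_def degree_le_def)
  then have "tuple_degree h' \<le> tuple_degree f' * tuple_degree f"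
    by (rule tuple_degree_le[OF multihom_nonzero[OF h'(1)]])
  then show thesis using that h' same_ratio_sym by blast
qed

section \<open>Iterates and their degrees\<close>

definition id_tuple :: "'n \<Rightarrow> ('k::field,'n::finite) site_poly" where
  "id_tuple j = variable (0, j)"

lemma multidegree_variable:
  assumes "m \<in> keys (variable (i, l) :: ('k::field,'n::finite) site_poly)"
  shows "multidegree m = (\<lambda>s. if s = i then 1 else 0)"
proof -
  have "m = single (i, l) 1" using assms by (simp add: variable_def)
  then show ?thesis by (auto simp: multidegree_def lookup_single when_def fun_eq_iff)
qed

lemma variable_nonzero: "(variable u :: ('k::field,'n::finite) site_poly) \<noteq> 0"
  unfolding keys_eq_empty[symmetric] by (simp add: variable_def)

lemma degree_le_variable: "degree_le 1 (variable u :: ('k::field,'n::finite) site_poly)"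
  by (simp add: degree_le_def variable_def)

lemma eval_id_tuple: "eval_tuple id_tuple x = x 0"
  by (simp add: vec_eq_iff id_tuple_def)

lemma represents_id: "represents id_tuple (\<lambda>v i. Some (v i :: ('k::alg_closed_field,'n::finite) proj))"
proof -
  have mh: "multihom (id_tuple :: 'n \<Rightarrow> ('k,'n) site_poly)"
    unfolding multihom_iff id_tuple_def using variable_nonzero multidegree_variable by blast
  have "ratmap id_tuple (shift i v) = Some (v i)" for i and v :: "('k,'n) config"
  proof -
    obtain x where x: "coords x (shift i v)" using coords_exist by blast
    then have "ratmap id_tuple (shift i v) = Some (pt (eval_tuple id_tuple x))"
      by (intro ratmap_at) (use mh multihom_nonzero in \<open>auto simp: eval_id_tuple coords_def\<close>)
    also have "pt (eval_tuple id_tuple x) = v i"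
      using x unfolding eval_id_tuple coords_def shift_def by (metis add_0_right)
    finally show ?thesis .
  qed
  then show ?thesis using mh by (simp add: represents_def lattice_map_of_def fun_eq_iff)
qed

lemma tuple_comp_id: "tuple_comp id_tuple f = (f :: 'n::finite \<Rightarrow> ('k::alg_closed_field,'n) site_poly)"
proof (rule ext, rule site_poly_eqI)
  fix j and x :: "int \<Rightarrow> 'k ^ 'n"
  have "shift 0 x = x" by (simp add: shift_def)
  then show "value_at (tuple_comp id_tuple f j) x = value_at (f j) x"
    by (simp add: value_tuple_comp id_tuple_def)
qed

lemma lattice_iterate_unique:
  fixes T :: "('k::alg_closed_field,'n::finite) lattice_map"
  assumes "lattice_iterate T m U" "lattice_iterate T m V" shows "U = V"
  using assms
proof (induction m arbitrary: U V)
  case 0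
  then show ?case by (auto elim: lattice_iterate.cases)
next
  case (Suc m)
  obtain U' where U': "lattice_iterate T m U'" "lattice_comp T U' U"
    using Suc.prems(1) by (cases rule: lattice_iterate.cases) auto
  obtain V' where V': "lattice_iterate T m V'" "lattice_comp T V' V"
    using Suc.prems(2) by (cases rule: lattice_iterate.cases) auto
  have "U' = V'" using Suc.IH U'(1) V'(1) .
  then show ?case using U'(2) V'(2) lattice_comp_unique by blast
qed

text \<open>This is \<open>T\<^sup>m\<^sup>+\<^sup>n = T\<^sup>m \<circ> T\<^sup>n\<close> on the level of tuples up to a common factor, while iterates are
  built only by composing with \<open>T\<close> on the left. In the induction step, associativity moves the new
  outer tuple onto \<open>g\<close>; a multihomogeneous component of the result that survives at some point of
  the image of \<open>T\<^sup>n\<close> is the next \<open>g\<close>.\<close>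

lemma iterate_add_tuple:
  fixes U :: "nat \<Rightarrow> ('k::alg_closed_field,'n::finite) lattice_map"
  assumes U0: "U 0 = (\<lambda>v i. Some (v i))" and step: "\<And>m. lattice_comp T (U m) (U (Suc m))"
    and T: "represents t T" and h: "\<And>m. represents (h m) (U m)"
  shows "\<exists>g. multihom g \<and> same_ratio (h m) g \<and> nonzero (tuple_comp g (h n)) \<and>
    same_ratio (h (m + n)) (tuple_comp g (h n))"
proof (induction m)
  case 0
  have "represents id_tuple (U 0)" unfolding U0 by (rule represents_id)
  then have "multihom (id_tuple :: 'n \<Rightarrow> ('k,'n) site_poly)" "same_ratio (h 0) id_tuple"
    using represents_same_ratio[OF h] by (auto simp: represents_def)
  moreover have "nonzero (h n)" using h[of n] multihom_nonzero unfolding represents_def by blast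
  ultimately show ?case by (intro exI[of _ id_tuple]) (simp add: tuple_comp_id)
next
  case (Suc m)
  have mh: "multihom (h m)" and nz: "nonzero (h m)" for m
    using h[of m] multihom_nonzero unfolding represents_def by blast+
  have t: "nonzero t" using T multihom_nonzero unfolding represents_def by blast
  obtain g where g: "multihom g" "same_ratio (h m) g" "nonzero (tuple_comp g (h n))"
      "same_ratio (h (m + n)) (tuple_comp g (h n))"
    using Suc by blast
  obtain k where k: "multihom k" "same_ratio t k" "nonzero (tuple_comp k (h m))"
      "same_ratio (h (Suc m)) (tuple_comp k (h m))"
    by (rule lattice_comp_tuple[OF step h T h])
  obtain k' where k': "multihom k'" "same_ratio t k'" "nonzero (tuple_comp k' (h (m + n)))"
      "same_ratio (h (Suc (m + n))) (tuple_comp k' (h (m + n)))"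
    by (rule lattice_comp_tuple[OF step h T h])
  have 1: "nonzero (tuple_comp k' (tuple_comp g (h n)))"
      "same_ratio (tuple_comp k' (h (m + n))) (tuple_comp k' (tuple_comp g (h n)))"
    using tuple_comp_right[OF k'(1) g(4) nz g(3) k'(3)] by auto
  let ?p = "tuple_comp k' g"
  have p_hn: "nonzero (tuple_comp ?p (h n))" using 1(1) by (simp add: tuple_comp_assoc)
  then obtain x where x: "eval_tuple ?p (\<lambda>i. eval_tuple (h n) (shift i x)) \<noteq> 0"
    using nonzero_eval eval_tuple_comp by metis
  then have p: "nonzero ?p" by (rule nonzero_if_eval)
  have "nonzero (tuple_comp k' (h m))" "same_ratio ?p (tuple_comp k' (h m))"
    using tuple_comp_right[OF k'(1) same_ratio_sym[OF g(2)] multihom_nonzero[OF g(1)] nz p] by auto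
  moreover have "same_ratio k' k" using k(2) k'(2) t same_ratio_sym same_ratio_trans by blast
  then have "same_ratio (tuple_comp k' (h m)) (tuple_comp k (h m))" by (rule tuple_comp_left)
  ultimately have "same_ratio ?p (tuple_comp k (h m))" using same_ratio_trans by blast
  then have ph: "same_ratio ?p (h (Suc m))" using k(3,4) same_ratio_sym same_ratio_trans by blast
  obtain g' where g': "multihom g'" "same_ratio g' (h (Suc m))"
      "eval_tuple g' (\<lambda>i. eval_tuple (h n) (shift i x)) \<noteq> 0"
    using multihom_component[OF mh ph x] by metis
  have "nonzero (tuple_comp g' (h n))"
    using g'(3) unfolding eval_tuple_comp[symmetric] by (rule nonzero_if_eval)
  moreover have "same_ratio ?p g'" using ph g'(2) nz same_ratio_sym same_ratio_trans by blast
  then have "same_ratio (tuple_comp ?p (h n)) (tuple_comp g' (h n))" by (rule tuple_comp_left)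
  then have "same_ratio (tuple_comp k' (h (m + n))) (tuple_comp g' (h n))"
    using 1 same_ratio_trans unfolding tuple_comp_assoc by blast
  then have "same_ratio (h (Suc m + n)) (tuple_comp g' (h n))"
    using k'(3,4) same_ratio_trans by fastforce
  ultimately show ?case using g'(1,2) same_ratio_sym by blast
qed

lemma lattice_degree_iterate_add:
  fixes U :: "nat \<Rightarrow> ('k::alg_closed_field,'n::finite) lattice_map"
  assumes "U 0 = (\<lambda>v i. Some (v i))" and step: "\<And>m. lattice_comp T (U m) (U (Suc m))"
    and "represents t T"
  shows "lattice_degree (U (m + n)) \<le> lattice_degree (U m) * lattice_degree (U n)"
proof -
  have "\<exists>h. represents h (U m)" for m
    using lattice_comp_represented[OF step[of m]] by blast
  then have "\<exists>h. represents h (U m) \<and> tuple_degree h = lattice_degree (U m)" for m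
    using lattice_degree_exists(2) by blast
  then obtain h where h: "\<And>m. represents (h m) (U m)" "\<And>m. tuple_degree (h m) = lattice_degree (U m)"
    by metis
  have mh: "multihom (h m)" for m using h(1) by (simp add: represents_def)
  obtain g where g: "same_ratio (h m) g" "nonzero (tuple_comp g (h n))"
      "same_ratio (h (m + n)) (tuple_comp g (h n))"
    using iterate_add_tuple[of U T t h m n] assms h(1) by blast
  obtain h' where h': "multihom h'" "same_ratio (h (m + n)) h'"
      "tuple_degree h' \<le> tuple_degree (h m) * tuple_degree (h n)"
    by (rule tuple_comp_degree[OF mh mh g])
  have "represents h' (U (m + n))" by (rule represents_cong[OF h(1) h'(2,1)])
  then have "lattice_degree (U (m + n)) \<le> tuple_degree h'" by (rule lattice_degree_exists(1))
  then show ?thesis using h' h(2) by simp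
qed

lemma lattice_degree_first_iterate:
  fixes T :: "('k::alg_closed_field,'n::finite) lattice_map"
  assumes T: "represents t T" and U: "lattice_comp T (\<lambda>v i. Some (v i)) U"
  shows "lattice_degree U \<le> tuple_degree t"
proof -
  obtain h where h: "represents h U" by (rule lattice_comp_represented[OF U])
  obtain g where g: "same_ratio t g" "nonzero (tuple_comp g id_tuple)"
      "same_ratio h (tuple_comp g id_tuple)"
    by (rule lattice_comp_tuple[OF U represents_id T h])
  obtain h' where h': "multihom h'" "same_ratio h h'"
      "tuple_degree h' \<le> tuple_degree t * tuple_degree (id_tuple :: 'n \<Rightarrow> ('k,'n) site_poly)"
    using tuple_comp_degree[of t h g id_tuple] g T h by (auto simp: represents_def)
  have "tuple_degree (id_tuple :: 'n \<Rightarrow> ('k,'n) site_poly) \<le> 1"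
  proof (rule tuple_degree_le)
    show "nonzero (id_tuple :: 'n \<Rightarrow> ('k,'n) site_poly)"
      unfolding id_tuple_def using variable_nonzero by blast
    show "total_degree m \<le> 1" if "m \<in> keys (id_tuple j :: ('k,'n) site_poly)" for j :: 'n and m
      using that degree_le_variable[of "(0, j)", where 'k = 'k] by (simp add: id_tuple_def degree_le_def)
  qed
  then have "tuple_degree t * tuple_degree (id_tuple :: 'n \<Rightarrow> ('k,'n) site_poly) \<le> tuple_degree t * 1"
    by (rule mult_le_mono2)
  moreover have "represents h' U" by (rule represents_cong[OF h h'(2,1)])
  then have "lattice_degree U \<le> tuple_degree h'" by (rule lattice_degree_exists(1))
  ultimately show ?thesis using h'(3) by linarith
qed

section \<open>Submultiplicative sequences\<close>

text \<open>Fekete's lemma in multiplicative form. Writing \<open>a n\<close> for the \<open>n\<close>-th root of \<open>D n\<close>, division of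
  \<open>n\<close> by a fixed \<open>k\<close> gives \<open>a n \<le> a k \<cdot> root n M\<close> with \<open>M\<close> independent of \<open>n\<close>, so that the
  infimum of \<open>a\<close> is its limit. A zero value makes all later values zero.\<close>

lemma root_submultiplicative_convergent:
  fixes D :: "nat \<Rightarrow> nat"
  assumes sub: "\<And>m n. D (m + n) \<le> D m * D n"
  shows "convergent (\<lambda>n. root n (real (D n)))"
proof (cases "\<exists>k. D k = 0")
  case True
  then obtain k where k: "D k = 0" by blast
  have "root n (real (D n)) = 0" if "n \<ge> k" for n
    using sub[of k "n - k"] that k by simp
  then have "eventually (\<lambda>n. root n (real (D n)) = 0) sequentially"
    by (auto simp: eventually_sequentially)
  then have "(\<lambda>n. root n (real (D n))) \<longlonglongrightarrow> 0" by (rule tendsto_eventually)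
  then show ?thesis by (rule convergentI)
next
  case False
  then have D1: "real (D k) \<ge> 1" for k by (metis less_one linorder_not_less of_nat_1 of_nat_le_iff)
  define a where "a n = root n (real (D n))" for n
  have a1: "a k \<ge> 1" if "k \<ge> 1" for k using D1 that by (simp add: a_def)
  have a_pow: "a k ^ k = real (D k)" if "k \<ge> 1" for k using that by (simp add: a_def)
  define L where "L = (INF k\<in>{1..}. a k)"
  have bdd: "bdd_below (a ` {1..})" using a1 by (auto intro!: bdd_belowI[of _ 1])
  have "a \<longlonglongrightarrow> L"
  proof (rule order_tendstoI)
    fix c assume c: "c < L"
    have "c < a n" if "n \<ge> 1" for n
      using c cINF_lower[OF bdd, of n] that by (simp add: L_def)
    then show "eventually (\<lambda>n. c < a n) sequentially" by (auto simp: eventually_sequentially)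
  next
    fix c assume "L < c"
    then obtain k where k: "k \<ge> 1" "a k < c"
      unfolding L_def using cINF_less_iff[OF _ bdd, of c] by auto
    define M where "M = real (Max (D ` {..<k}))"
    have M: "real (D r) \<le> M" if "r < k" for r using that by (simp add: M_def)
    have M1: "M > 0" using M[of 0] D1[of 0] k by simp
    have mult: "D (q * k + r) \<le> D k ^ q * D r" for q r
    proof (induction q)
      case (Suc q)
      have "D (Suc q * k + r) = D (k + (q * k + r))" by (simp add: algebra_simps)
      also have "\<dots> \<le> D k * D (q * k + r)" by (rule sub)
      also have "\<dots> \<le> D k * (D k ^ q * D r)" using Suc by simp
      finally show ?case by (simp add: algebra_simps)
    qed simp
    have bound: "a n \<le> a k * root n M" if n: "n \<ge> 1" for n
    proof -
      have "D n \<le> D k ^ (n div k) * D (n mod k)" using mult[of "n div k" "n mod k"] by simp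
      then have "real (D n) \<le> real (D k) ^ (n div k) * real (D (n mod k))"
        by (metis of_nat_le_iff of_nat_mult of_nat_power)
      also have "\<dots> \<le> real (D k) ^ (n div k) * M"
        using M[of "n mod k"] k by (intro mult_left_mono) auto
      also have "\<dots> = a k ^ (k * (n div k)) * M" using a_pow[OF k(1)] by (simp add: power_mult)
      also have "\<dots> \<le> a k ^ n * M"
        using a1[OF k(1)] M1 by (intro mult_right_mono power_increasing) auto
      finally have "a n \<le> root n (a k ^ n * M)" using n by (simp add: a_def)
      also have "\<dots> = a k * root n M"
        using n a1[OF k(1)] by (simp add: real_root_mult real_root_power_cancel)
      finally show ?thesis .
    qed
    have "(\<lambda>n. a k * root n M) \<longlonglongrightarrow> a k * 1"
      by (intro tendsto_mult tendsto_const LIMSEQ_root_const M1)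
    then have "eventually (\<lambda>n. a k * root n M < c) sequentially"
      using k(2) by (intro order_tendstoD) auto
    then show "eventually (\<lambda>n. a n < c) sequentially"
      using eventually_ge_at_top[of 1] by eventually_elim (use bound in force)
  qed
  then show ?thesis unfolding a_def by (rule convergentI)
qed

lemma lim_root_le_first:
  fixes D :: "nat \<Rightarrow> nat"
  assumes sub: "\<And>m n. D (m + n) \<le> D m * D n"
  shows "lim (\<lambda>n. root n (real (D n))) \<le> real (D 1)"
proof (rule LIMSEQ_le_const2)
  show "(\<lambda>n. root n (real (D n))) \<longlonglongrightarrow> lim (\<lambda>n. root n (real (D n)))"
    using root_submultiplicative_convergent[OF sub] by (simp add: convergent_LIMSEQ_iff)
  have pow: "D (Suc n) \<le> D 1 ^ Suc n" for n
  proof (induction n)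
    case (Suc n)
    have "D (1 + Suc n) \<le> D 1 * D (Suc n)" by (rule sub)
    also have "\<dots> \<le> D 1 * D 1 ^ Suc n" using Suc by simp
    finally show ?case by simp
  qed simp
  have "root n (real (D n)) \<le> real (D 1)" if "n \<ge> 1" for n
  proof -
    have "D n \<le> D 1 ^ n" using pow[of "n - 1"] that by simp
    then have "real (D n) \<le> real (D 1) ^ n" by (metis of_nat_le_iff of_nat_power)
    then have "root n (real (D n)) \<le> root n (real (D 1) ^ n)" using that by simp
    then show ?thesis using that by (simp add: real_root_power_cancel)
  qed
  then show "\<exists>N. \<forall>n\<ge>N. root n (real (D n)) \<le> real (D 1)" by blast
qed

lemma lim_root_eventually_const:
  fixes D :: "nat \<Rightarrow> nat"
  assumes "\<And>n. n \<ge> N \<Longrightarrow> D n = C"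
  shows "lim (\<lambda>n. root n (real (D n))) \<le> 1"
proof -
  have "(\<lambda>n. root n (real C)) \<longlonglongrightarrow> (if C = 0 then 0 else 1)"
    using LIMSEQ_root_const[of "real C"] by auto
  moreover have "eventually (\<lambda>n. root n (real C) = root n (real (D n))) sequentially"
    using assms by (auto simp: eventually_sequentially)
  ultimately have "(\<lambda>n. root n (real (D n))) \<longlonglongrightarrow> (if C = 0 then 0 else 1)"
    by (rule Lim_transform_eventually)
  then show ?thesis by (auto simp: limI)
qed

text \<open>The degrees of the iterates are submultiplicative, and the first is at most \<open>tuple_degree t\<close>.
  The 1 accounts for maps with an undefined iterate, as the roots of a positive constant tend to 1.\<close>

theorem dynamical_degree_le_tuple_degree:
  fixes T :: "('k::alg_closed_field,'n::finite) lattice_map"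
  assumes T: "represents t T"
  shows "dynamical_degree T \<le> real (max 1 (tuple_degree t))"
proof (cases "iterable T")
  case True
  define U where "U m = (THE U. lattice_iterate T m U)" for m
  have U: "lattice_iterate T m (U m)" for m
    using True lattice_iterate_unique unfolding iterable_def U_def by (metis theI)
  have U0: "U 0 = (\<lambda>v i. Some (v i))"
    by (rule lattice_iterate_unique[OF U]) (rule lattice_iterate.intros)
  have step: "lattice_comp T (U m) (U (Suc m))" for m
  proof -
    obtain V where "lattice_iterate T m V" "lattice_comp T V (U (Suc m))"
      using U[of "Suc m"] by (cases rule: lattice_iterate.cases) auto
    then show ?thesis using lattice_iterate_unique[OF U[of m]] by blast
  qed
  have "dynamical_degree T = lim (\<lambda>m. root m (real (lattice_degree (U m))))"
    by (simp add: dynamical_degree_def U_def)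
  also have "\<dots> \<le> real (lattice_degree (U 1))"
    by (rule lim_root_le_first) (rule lattice_degree_iterate_add[OF U0 step T])
  also have "lattice_degree (U 1) \<le> tuple_degree t"
    using lattice_degree_first_iterate[OF T] step[of 0] by (simp add: U0)
  finally show ?thesis by simp
next
  case False
  then obtain N where N: "\<nexists>U. lattice_iterate T N U" unfolding iterable_def by blast
  have "\<nexists>U. lattice_iterate T m U" if "m \<ge> N" for m
    using that
  proof (induction m rule: dec_induct)
    case (step m)
    then show ?case by (auto elim: lattice_iterate.cases)
  qed (rule N)
  \<comment> \<open>Beyond the first missing iterate, the description operator returns one and the same map.\<close>
  then have "(THE U. lattice_iterate T m U) = (THE U. False)" if "m \<ge> N" for m using that by simp
  then have "dynamical_degree T \<le> 1"
    unfolding dynamical_degree_def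
    by (intro lim_root_eventually_const[of N _ "lattice_degree (THE U. False)"]) simp
  then show ?thesis by simp
qed

section \<open>Skew pentagram maps\<close>

text \<open>Cross products are needed over the field and over its polynomials.\<close>

definition cross :: "'r::comm_ring_1 ^ 3 \<Rightarrow> 'r ^ 3 \<Rightarrow> 'r ^ 3" where
  "cross x y = vector [x $ 2 * y $ 3 - x $ 3 * y $ 2, x $ 3 * y $ 1 - x $ 1 * y $ 3,
    x $ 1 * y $ 2 - x $ 2 * y $ 1]"

definition dot :: "'r::comm_ring_1 ^ 3 \<Rightarrow> 'r ^ 3 \<Rightarrow> 'r" where
  "dot x y = x $ 1 * y $ 1 + x $ 2 * y $ 2 + x $ 3 * y $ 3"

lemma cross_nth [simp]:
  "cross x y $ 1 = x $ 2 * y $ 3 - x $ 3 * y $ 2"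
  "cross x y $ 2 = x $ 3 * y $ 1 - x $ 1 * y $ 3"
  "cross x y $ 3 = x $ 1 * y $ 2 - x $ 2 * y $ 1"
  by (simp_all add: cross_def vector_3)

lemma cross_eq_0_iff: "cross x y = 0 \<longleftrightarrow> (\<forall>i j. x $ i * y $ j = x $ j * y $ i)"
  by (auto simp: vec_eq_iff forall_3 algebra_simps)

lemma pt_eq_iff_cross:
  fixes x y :: "'k::field ^ 3"
  assumes "x \<noteq> 0" "y \<noteq> 0" shows "pt x = pt y \<longleftrightarrow> cross x y = 0"
  unfolding pt_eq_iff_minors[OF assms] cross_eq_0_iff ..

lemma in_span_pair: "z \<in> vec.span {x, y} \<longleftrightarrow> (\<exists>a b. z = a *s x + b *s y)"
  by (auto simp: vec.span_insert vec.span_singleton algebra_simps)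

text \<open>A plane is the kernel of its normal vector. The converse direction is Cramer's rule for \<open>z\<close>
  in terms of \<open>x\<close>, \<open>y\<close> and a coordinate vector outside the plane.\<close>

lemma in_span_pair_iff_dot:
  fixes x y z :: "'k::field ^ 3"
  assumes "cross x y \<noteq> 0"
  shows "z \<in> vec.span {x, y} \<longleftrightarrow> dot (cross x y) z = 0"
proof
  assume "z \<in> vec.span {x, y}"
  then show "dot (cross x y) z = 0" by (auto simp: in_span_pair dot_def algebra_simps)
next
  assume d: "dot (cross x y) z = 0"
  obtain j where j: "cross x y $ j \<noteq> 0" using assms by (auto simp: vec_eq_iff)
  have cramer: "\<forall>j i. cross x y $ j * z $ i = cross z y $ j * x $ i + cross x z $ j * y $ i
      + (if i = j then dot (cross x y) z else 0)"
    by (auto simp: forall_3 dot_def algebra_simps)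
  have "z = (cross z y $ j / cross x y $ j) *s x + (cross x z $ j / cross x y $ j) *s y"
    unfolding vec_eq_iff using cramer[rule_format, of j] j d by (simp add: field_simps)
  then show "z \<in> vec.span {x, y}" using in_span_pair by blast
qed

lemma dot_both_zero_imp_multiple:
  fixes m n z :: "'k::field ^ 3"
  assumes w: "cross m n \<noteq> 0" and "dot m z = 0" "dot n z = 0"
  shows "\<exists>c. z = c *s cross m n"
proof -
  have "cross z (cross m n) = dot n z *s m - dot m z *s n"
    by (auto simp: vec_eq_iff forall_3 dot_def algebra_simps)
  then have 0: "\<forall>i j. z $ i * cross m n $ j = z $ j * cross m n $ i"
    using assms(2,3) cross_eq_0_iff[of z "cross m n"] by simp
  obtain j where j: "cross m n $ j \<noteq> 0" using w by (auto simp: vec_eq_iff)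
  have "z = (z $ j / cross m n $ j) *s cross m n"
    unfolding vec_eq_iff using 0 j by (simp add: field_simps)
  then show ?thesis by blast
qed

lemma dot_cross: "dot m (cross m n) = 0" "dot n (cross m n) = 0"
  by (simp_all add: dot_def algebra_simps)

lemma line_through_pt:
  assumes "x \<noteq> 0" "y \<noteq> 0" shows "line_through (pt x) (pt y) = vec.span {x, y}"
proof
  have "vec.span {x} \<union> vec.span {y} \<subseteq> vec.span {x, y}" by (simp add: vec.span_mono)
  then show "line_through (pt x) (pt y) \<subseteq> vec.span {x, y}"
    unfolding line_through_def Rep_pt[OF assms(1)] Rep_pt[OF assms(2)]
    by (rule vec.span_minimal) simp
  have "{x, y} \<subseteq> vec.span {x} \<union> vec.span {y}" by (simp add: vec.span_base)
  then show "vec.span {x, y} \<subseteq> line_through (pt x) (pt y)"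
    unfolding line_through_def Rep_pt[OF assms(1)] Rep_pt[OF assms(2)] by (rule vec.span_mono)
qed

text \<open>The lines through two pairs of points have the cross products of the pairs as normal vectors;
  the common point of two lines is orthogonal to both normal vectors.\<close>

definition meet :: "'r::comm_ring_1 ^ 3 \<Rightarrow> 'r ^ 3 \<Rightarrow> 'r ^ 3 \<Rightarrow> 'r ^ 3 \<Rightarrow> 'r ^ 3" where
  "meet x y z w = cross (cross x y) (cross z w)"

lemma meet_of_lines:
  fixes x y z w :: "'k::field ^ 3"
  assumes nz: "x \<noteq> 0" "y \<noteq> 0" "z \<noteq> 0" "w \<noteq> 0"
  shows "pt x \<noteq> pt y \<and> pt z \<noteq> pt w \<and>
      line_through (pt x) (pt y) \<noteq> line_through (pt z) (pt w) \<longleftrightarrow> meet x y z w \<noteq> 0"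
    and "meet x y z w \<noteq> 0 \<Longrightarrow>
      line_through (pt x) (pt y) \<inter> line_through (pt z) (pt w) = vec.span {meet x y z w}"
proof -
  let ?m = "cross x y" and ?n = "cross z w"
  have mn: "?m \<noteq> 0" "?n \<noteq> 0" if "meet x y z w \<noteq> 0"
    using that by (auto simp: meet_def vec_eq_iff forall_3)
  show inter: "line_through (pt x) (pt y) \<inter> line_through (pt z) (pt w) = vec.span {meet x y z w}"
    if ne: "meet x y z w \<noteq> 0"
  proof -
    have "u \<in> vec.span {x, y} \<inter> vec.span {z, w} \<longleftrightarrow> u \<in> vec.span {meet x y z w}" for u
    proof -
      have "u \<in> vec.span {x, y} \<inter> vec.span {z, w} \<longleftrightarrow> dot ?m u = 0 \<and> dot ?n u = 0"
        using in_span_pair_iff_dot mn[OF ne] by blast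
      also have "\<dots> \<longleftrightarrow> (\<exists>c. u = c *s meet x y z w)"
      proof
        assume "\<exists>c. u = c *s meet x y z w"
        then obtain c where c: "u = c *s meet x y z w" by blast
        have "dot p (c *s q) = c * dot p q" for p q :: "'k ^ 3" by (simp add: dot_def algebra_simps)
        then show "dot ?m u = 0 \<and> dot ?n u = 0" by (simp add: c meet_def dot_cross)
      qed (use dot_both_zero_imp_multiple ne in \<open>auto simp: meet_def\<close>)
      finally show ?thesis by (auto simp: vec.span_singleton)
    qed
    then show ?thesis using line_through_pt nz by blast
  qed
  show "pt x \<noteq> pt y \<and> pt z \<noteq> pt w \<and>
      line_through (pt x) (pt y) \<noteq> line_through (pt z) (pt w) \<longleftrightarrow> meet x y z w \<noteq> 0"
  proof
    assume gen: "pt x \<noteq> pt y \<and> pt z \<noteq> pt w \<and> line_through (pt x) (pt y) \<noteq> line_through (pt z) (pt w)"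
    then have m: "?m \<noteq> 0" and n: "?n \<noteq> 0" using pt_eq_iff_cross nz by blast+
    show "meet x y z w \<noteq> 0"
    proof
      assume "meet x y z w = 0"
      then have "pt ?m = pt ?n" using pt_eq_iff_cross[OF m n] by (simp add: meet_def)
      then obtain c where "c \<noteq> 0" "?m = c *s ?n" using pt_eq_iff[OF m n] by blast
      then have "dot ?m u = c * dot ?n u" for u by (simp add: dot_def algebra_simps)
      then have "u \<in> vec.span {x, y} \<longleftrightarrow> u \<in> vec.span {z, w}" for u
        using \<open>c \<noteq> 0\<close> by (simp add: in_span_pair_iff_dot[OF m] in_span_pair_iff_dot[OF n])
      then show False using gen line_through_pt nz by blast
    qed
  next
    assume ne: "meet x y z w \<noteq> 0"
    have "line_through (pt x) (pt y) \<noteq> line_through (pt z) (pt w)"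
    proof
      assume "line_through (pt x) (pt y) = line_through (pt z) (pt w)"
      then have "vec.span {x, y} = vec.span {meet x y z w}"
        using inter[OF ne] line_through_pt[OF nz(1,2)] by (metis Int_absorb)
      then have "x \<in> vec.span {meet x y z w}" "y \<in> vec.span {meet x y z w}"
        by (metis insertCI vec.span_base)+
      then obtain s t where "x = s *s meet x y z w" "y = t *s meet x y z w"
        unfolding vec.span_singleton by blast
      then have "x $ i * y $ j = x $ j * y $ i" for i j
        by (metis (no_types, lifting) mult.assoc mult.commute vector_smult_component)
      then have "?m = 0" unfolding cross_eq_0_iff by blast
      then show False using mn(1)[OF ne] by simp
    qed
    then show "pt x \<noteq> pt y \<and> pt z \<noteq> pt w \<and> line_through (pt x) (pt y) \<noteq> line_through (pt z) (pt w)"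
      using mn[OF ne] pt_eq_iff_cross nz by blast
  qed
qed

definition site_variables :: "int \<Rightarrow> ('k::field, 3) site_poly ^ 3" where
  "site_variables i = (\<chi> l. variable (i, l))"

definition pentagram_tuple :: "int \<Rightarrow> int \<Rightarrow> int \<Rightarrow> int \<Rightarrow> 3 \<Rightarrow> ('k::field, 3) site_poly" where
  "pentagram_tuple a b c d j =
     meet (site_variables a) (site_variables b) (site_variables c) (site_variables d) $ j"

lemma eval_pentagram_tuple:
  "eval_tuple (pentagram_tuple a b c d) x = meet (x a) (x b) (x c) (x d)"
  by (simp add: vec_eq_iff forall_3 pentagram_tuple_def meet_def site_variables_def
      eval_poly.hom_minus eval_poly.hom_mult)

definition homogeneous :: "(int \<Rightarrow> nat) \<Rightarrow> ('k::field, 'n::finite) site_poly \<Rightarrow> bool" where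
  "homogeneous d p \<longleftrightarrow> (\<forall>m\<in>keys p. multidegree m = d)"

lemma homogeneous_mult:
  assumes "homogeneous d p" "homogeneous e q" shows "homogeneous (\<lambda>i. d i + e i) (p * q)"
  unfolding homogeneous_def
proof
  fix m assume "m \<in> keys (p * q)"
  then obtain r s where "m = r + s" "r \<in> keys p" "s \<in> keys q" using keys_mult by fastforce
  then show "multidegree m = (\<lambda>i. d i + e i)"
    using assms by (simp add: homogeneous_def multidegree_add)
qed

lemma homogeneous_minus: "homogeneous d p \<Longrightarrow> homogeneous d q \<Longrightarrow> homogeneous d (p - q)"
  unfolding homogeneous_def using keys_diff[of p q] by blast

lemma homogeneous_cross:
  assumes "\<And>j. homogeneous d (x $ j)" "\<And>j. homogeneous e (y $ j)"
  shows "homogeneous (\<lambda>i. d i + e i) (cross x y $ j)"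
proof -
  have "homogeneous (\<lambda>i. d i + e i) (x $ k * y $ l)" for k l
    by (rule homogeneous_mult[OF assms])
  then have "\<forall>j. homogeneous (\<lambda>i. d i + e i) (cross x y $ j)"
    by (simp add: forall_3 homogeneous_minus)
  then show ?thesis by blast
qed

lemma degree_le_cross:
  fixes x y :: "('k::field, 'n::finite) site_poly ^ 3"
  assumes "\<And>j. degree_le m (x $ j)" "\<And>j. degree_le n (y $ j)"
  shows "degree_le (m + n) (cross x y $ j)"
proof -
  have "degree_le (m + n) (x $ k * y $ l)" for k l by (rule degree_le_mult[OF assms])
  then have "\<forall>j. degree_le (m + n) (cross x y $ j)" by (simp add: forall_3 degree_le_minus)
  then show ?thesis by blast
qed

lemma multihom_pentagram_tuple:
  assumes "distinct [a, b, c, d]"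
  shows "multihom_tuple {a, b, c, d} (pentagram_tuple a b c d :: 3 \<Rightarrow> ('k::field, 3) site_poly)"
proof -
  let ?f = "pentagram_tuple a b c d :: 3 \<Rightarrow> ('k, 3) site_poly"
  \<comment> \<open>The sites \<open>a\<close> and \<open>d\<close> both carry the first coordinate point: the lines are two sides of the
    coordinate triangle.\<close>
  define x :: "int \<Rightarrow> 'k ^ 3" where
    "x i = axis (if i = b then 2 else if i = c then 3 else 1) 1" for i
  have "meet (x a) (x b) (x c) (x d) \<noteq> 0"
    using assms by (simp add: x_def meet_def vec_eq_iff forall_3 axis_def)
  then have nz: "nonzero ?f" unfolding eval_pentagram_tuple[symmetric] by (rule nonzero_if_eval)
  define e :: "int \<Rightarrow> int \<Rightarrow> nat" where "e i = (\<lambda>s. if s = i then 1 else 0)" for i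
  define D where "D = (\<lambda>i. (e a i + e b i) + (e c i + e d i))"
  have "homogeneous (e i) (site_variables i $ l :: ('k, 3) site_poly)" for i l
    unfolding homogeneous_def site_variables_def e_def vec_lambda_beta
    by (intro ballI multidegree_variable)
  then have D: "homogeneous D (?f j)" for j
    unfolding D_def pentagram_tuple_def meet_def by (intro homogeneous_cross)
  have "keys m \<subseteq> {a, b, c, d} \<times> UNIV" if "m \<in> keys (?f j)" for j m
  proof
    fix u assume u: "u \<in> keys m"
    have "multidegree m (fst u) \<noteq> 0" using u multidegree_eq_0_iff[of m "fst u"] by auto
    moreover have "multidegree m = D" using D[of j] that by (simp add: homogeneous_def)
    ultimately have "fst u \<in> {a, b, c, d}" by (auto simp: D_def e_def split: if_splits)
    then show "u \<in> {a, b, c, d} \<times> UNIV" by (cases u) simp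
  qed
  moreover have "multihom ?f" using nz D unfolding multihom_iff homogeneous_def by blast
  ultimately show ?thesis using multihom_tuple_iff by blast
qed

lemma tuple_degree_pentagram_tuple:
  assumes "distinct [a, b, c, d]"
  shows "tuple_degree (pentagram_tuple a b c d :: 3 \<Rightarrow> ('k::field, 3) site_poly) \<le> 4"
proof (rule tuple_degree_le)
  show "nonzero (pentagram_tuple a b c d :: 3 \<Rightarrow> ('k, 3) site_poly)"
    using multihom_pentagram_tuple[OF assms, where 'k = 'k] by (simp add: multihom_tuple_def)
  have "degree_le 1 (site_variables i $ l :: ('k, 3) site_poly)" for i l
    using degree_le_variable by (simp add: site_variables_def)
  then have "degree_le ((1 + 1) + (1 + 1)) (pentagram_tuple a b c d j :: ('k, 3) site_poly)" for j
    unfolding pentagram_tuple_def meet_def by (intro degree_le_cross)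
  then show "total_degree m \<le> 4" if "m \<in> keys (pentagram_tuple a b c d j :: ('k, 3) site_poly)" for j m
    using that by (force simp: degree_le_def)
qed

text \<open>Configurations in general position are those at which the tuple does not vanish, so they form
  a dense open set, and a rational map with the prescribed values there is determined.\<close>

lemma represents_skew_pentagram:
  assumes "distinct [a, b, c, d]"
  shows "represents (pentagram_tuple a b c d) (skew_pentagram a b c d :: ('k::alg_closed_field, 3) lattice_map)"
proof -
  let ?f = "pentagram_tuple a b c d :: 3 \<Rightarrow> ('k, 3) site_poly"
  let ?S = "{a, b, c, d}"
  note mhS = multihom_pentagram_tuple[OF assms, where 'k = 'k]
  have mh: "multihom ?f" using mhS multihom_tuple_iff by blast
  define gen where "gen v \<longleftrightarrow> v a \<noteq> v b \<and> v c \<noteq> v d \<and>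
    line_through (v a) (v b) \<noteq> line_through (v c) (v d)" for v :: "('k, 3) config"
  define spec where "spec \<phi> \<longleftrightarrow> (\<forall>v. gen v \<longrightarrow> (\<exists>q. \<phi> v = Some q \<and>
      Rep_proj q = line_through (v a) (v b) \<inter> line_through (v c) (v d)))"
    for \<phi> :: "('k, 3) config \<rightharpoonup> ('k, 3) proj"
  have gen_iff: "gen v \<longleftrightarrow> eval_tuple ?f x \<noteq> 0"
    and Rep: "eval_tuple ?f x \<noteq> 0 \<Longrightarrow>
      line_through (v a) (v b) \<inter> line_through (v c) (v d) = Rep_proj (pt (eval_tuple ?f x))"
    if "coords x v" for x v
    using meet_of_lines[of "x a" "x b" "x c" "x d"] that
    by (auto simp: gen_def coords_def eval_pentagram_tuple Rep_pt)
  have "skew_pentagram a b c d = (THE T. \<exists>\<phi>. local_rule ?S \<phi> T \<and> spec \<phi>)"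
    by (simp add: skew_pentagram_def spec_def gen_def)
  also have "\<dots> = lattice_map_of (ratmap ?f)"
  proof (rule the_equality)
    have "spec (ratmap ?f)"
      unfolding spec_def
    proof (intro allI impI)
      fix v assume v: "gen v"
      obtain x where x: "coords x v" using coords_exist by blast
      have "eval_tuple ?f x \<noteq> 0" using gen_iff[OF x] v by simp
      moreover from this have "ratmap ?f v = Some (pt (eval_tuple ?f x))"
        by (intro ratmap_at) (use mh multihom_nonzero x in auto)
      ultimately show "\<exists>q. ratmap ?f v = Some q \<and>
          Rep_proj q = line_through (v a) (v b) \<inter> line_through (v c) (v d)"
        using Rep[OF x] by simp
    qed
    moreover have "local_rule ?S (ratmap ?f) (lattice_map_of (ratmap ?f))"
      unfolding local_rule_def rational_map_def
      using mhS rational_map_of_eq_ratmap[OF mhS] by (metis finite.simps insert_not_empty)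
    ultimately show "\<exists>\<phi>. local_rule ?S \<phi> (lattice_map_of (ratmap ?f)) \<and> spec \<phi>" by blast
  next
    fix T assume "\<exists>\<phi>. local_rule ?S \<phi> T \<and> spec \<phi>"
    then obtain \<phi> where \<phi>: "local_rule ?S \<phi> T" "spec \<phi>" by blast
    obtain g where g: "represents g T" by (rule local_rule_represents[OF \<phi>(1)])
    then have \<phi>g: "\<phi> = ratmap g" and mhg: "multihom g"
      using local_rule_unique[OF \<phi>(1)] by (auto simp: represents_def)
    have "same_ratio g ?f"
    proof (rule same_ratio_if_agree[of "{}"])
      fix x :: "int \<Rightarrow> 'k ^ 3"
      assume x0: "\<And>i. x i \<noteq> 0" and gx: "eval_tuple g x \<noteq> 0" and fx: "eval_tuple ?f x \<noteq> 0"
      define v where "v i = pt (x i)" for i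
      have x: "coords x v" using x0 by (simp add: coords_def v_def)
      have "ratmap g v = Some (pt (eval_tuple g x))"
        by (rule ratmap_at[OF mhg]) (use mhg multihom_nonzero x gx in auto)
      moreover obtain q where "\<phi> v = Some q"
          "Rep_proj q = line_through (v a) (v b) \<inter> line_through (v c) (v d)"
        using \<phi>(2) gen_iff[OF x] fx unfolding spec_def by blast
      moreover note Rep[OF x fx]
      ultimately show "pt (eval_tuple g x) = pt (eval_tuple ?f x)"
        using \<phi>g Rep_proj_inject by (metis option.inject)
    qed auto
    then have "ratmap g = ratmap ?f" using ratmap_eq_iff[OF mhg mh] by simp
    then show "T = lattice_map_of (ratmap ?f)" using g by (simp add: represents_def)
  qed
  finally show ?thesis using mh by (simp add: represents_def)
qed

theorem proposition5p2:
  fixes a b c d :: int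
  assumes "distinct [a, b, c, d]"
  shows "dynamical_degree (skew_pentagram a b c d :: ('k :: alg_closed_field, 3) lattice_map) \<le> 4"
proof -
  let ?f = "pentagram_tuple a b c d :: 3 \<Rightarrow> ('k, 3) site_poly"
  have "tuple_degree ?f \<le> 4" by (rule tuple_degree_pentagram_tuple[OF assms])
  moreover have "dynamical_degree (skew_pentagram a b c d :: ('k, 3) lattice_map) \<le> real (max 1 (tuple_degree ?f))"
    by (rule dynamical_degree_le_tuple_degree[OF represents_skew_pentagram[OF assms]])
  ultimately show ?thesis by linarith
qed

end
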